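(* Suppose that the problem $\min\{g(x)+f(w): Ax+Bw=b\}$ satisfies the standing assumption, and let $(\bar x,\bar w,\bar y)$ be a saddle point of $\mathbb{L}$. Let the sequence $\{(x_k,w_k,y_k)\}_{k\ge1}$ be generated by Algorithm 3 (described in the context). Then: (a) The sequence $\{(x_k,w_k,y_k)\}_{k\ge1}$ converges to a saddle point of $\mathbb{L}$. (b) With $k_5\in\mathbb{N}$ the index described in the context and $$\tilde x_N:=\frac1{N'}\sum_{k=k_5}^N x_k,\qquad \tilde w_N:=\frac1{N'}\sum_{k=k_5}^N w_k,\qquad N':=N-k_5+1,$$ the averaged (ergodic) sequences $\{\tilde x_N\}$ and $\{\tilde w_N\}$ satisfy $$\big|\Phi(\tilde x_N,\tilde w_N)-\Phi^\star\big|=\mathcal{O}(1/N')\qquad\text{and}\qquad\|A\tilde x_N+B\tilde w_N-b\|=\mathcal{O}(1/N').$$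
   Context: **Problem.** $g:\mathbb{R}^q\to\mathbb{R}\cup\{+\infty\}$ and $f:\mathbb{R}^p\to\mathbb{R}\cup\{+\infty\}$ are proper, closed, convex functions, $A\in\mathbb{R}^{m\times q}$, $B\in\mathbb{R}^{m\times p}$, $b\in\mathbb{R}^m$. The problem is $\min_{x\in\mathbb{R}^q,\,w\in\mathbb{R}^p} g(x)+f(w)$ subject to $Ax+Bw=b$. Set $\Phi(x,w):=g(x)+f(w)$, $\Phi^\star:=\min\{\Phi(x,w):Ax+Bw=b\}$, $\mathbb{L}(x,w,y):=\Phi(x,w)+\langle y,Ax+Bw-b\rangle$ and, for $\sigma>0$, $\mathbb{L}_\sigma(x,w,y):=\mathbb{L}(x,w,y)+\frac{\sigma}{2}\|Ax+Bw-b\|^2$. A triple $(x^\star,w^\star,y^\star)$ is a saddle point of $\mathbb{L}$ if $\mathbb{L}(x^\star,w^\star,y)\le\mathbb{L}(x^\star,w^\star,y^\star)\le\mathbb{L}(x,w,y^\star)$ for all $(x,w,y)\in\mathbb{R}^q\times\mathbb{R}^p\times\mathbb{R}^m$. **Standing assumption.** The solution set of the problem is nonempty, and there exist $\tilde x\in\operatorname{ri}(\operatorname{dom} g)$ and $\tilde w\in\operatorname{ri}(\operatorname{dom} f)$ with $A\tilde x+B\tilde w=b$ ($\operatorname{ri}$ = relative interior). **Notation.** $\mathbb{N}=\{1,2,\dots\}$. $\|\cdot\|$ is the Euclidean norm. For a symmetric positive semidefinite $M$, $\|y\|_M:=\sqrt{y^\top My}$. $\lambda_{\min}(M)$ is the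 smallest eigenvalue of $M$. $\varphi:=\frac{1+\sqrt5}{2}$. **Algorithm 3.** Let $S\in\mathbb{R}^{q\times q}$ and $T\in\mathbb{R}^{p\times p}$ be symmetric positive definite, $x_0\in\mathbb{R}^q$, $w_0\in\mathbb{R}^p$, $y_0\in\mathbb{R}^m$, $u_0=x_0$, $\tau_0>0$, $\beta>0$, $\psi\in(1,\varphi)$, $\rho\in[1,\frac1\psi+\frac1{\psi^2}]$, $0<r_1<r<\frac\rho2$. Let $(\xi_k)_{k\ge0}$ be a real sequence with $\rho+\xi_k>1$ for all $k$ and $\sum_{k=1}^\infty\log(\rho+\xi_k)<+\infty$. Set $\bar\lambda:=\lambda_{\min}(S)$. For $k=1,2,\dots$: $$u_k=\tfrac{\psi-1}{\psi}x_{k-1}+\tfrac1\psi u_{k-1},\qquad x_k=\arg\min_x\Big\{\mathbb{L}(x,w_{k-1},y_{k-1})+\tfrac1{2\tau_{k-1}}\|x-u_k\|_S^2\Big\},$$ $$\tau_k=\begin{cases}\dfrac{r_1\sqrt{\bar\lambda}}{\sqrt\beta\,L_k},&\text{if }\tau_{k-1}L_k>\dfrac{r\sqrt{\bar\lambda}}{\sqrt\beta},\\[2mm](\rho+\xi_{k-1})\tau_{k-1},&\text{otherwise,}\end{cases}\qquad\sigma_k=\beta\tau_k,$$ where $L_k:=\frac{\|Ax_k-Ax_{k-1}\|}{\|x_k-x_{k-1}\|}$ if $x_k\ne x_{k-1}$ (and the "otherwise" branch is used if $x_k=x_{k-1}$), $$w_k=\arg\min_w\Big\{\mathbb{L}_{\sigma_k}(x_k,w,y_{k-1})+\tfrac1{2\sigma_k}\|w-w_{k-1}\|_T^2\Big\},\qquad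 y_k=y_{k-1}+\sigma_k(Ax_k+Bw_k-b).$$ **The index $k_5$.** $k_5\in\mathbb{N}$ is a natural number such that for all $k\ge k_5$ and all $y\in\mathbb{R}^m$ $$\begin{aligned}2\tau_k\big(\mathbb{L}(x_k,w_k,y)-\Phi^\star\big)\le{}&\tfrac{\psi}{\psi-1}\big(\|u_{k+1}-\bar x\|_S^2-\|u_{k+2}-\bar x\|_S^2\big)+\tfrac1\beta\big(\|\bar w-w_{k-1}\|_T^2-\|\bar w-w_k\|_T^2\big)\\&+\tfrac1\beta\big(\|y-y_{k-1}\|^2-\|y-y_k\|^2\big)-\tfrac1\beta\|w_k-w_{k-1}\|_T^2\\&-\tfrac1\beta\big(1-\tfrac\rho2\big)\|y_k-y_{k-1}\|^2-\tfrac{\psi\tau_k}{\tau_{k-1}}\|x_k-u_{k+1}\|_S^2.\end{aligned}$$ Such a $k_5$ always exists. *)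

theory Defs
  imports "HOL-Analysis.Analysis" "HOL-Library.Landau_Symbols"
begin

section \<open>Extended-valued convex functions\<close>

definition edom :: "('a \<Rightarrow> ereal) \<Rightarrow> 'a set" where
  "edom h = {z. h z < \<infinity>}"

definition epi :: "('a \<Rightarrow> ereal) \<Rightarrow> ('a \<times> real) set" where
  "epi h = {(z, t). h z \<le> ereal t}"

definition proper_closed_convex :: "('a::euclidean_space \<Rightarrow> ereal) \<Rightarrow> bool" where
  "proper_closed_convex h \<longleftrightarrow>
     (\<forall>z. h z \<noteq> -\<infinity>) \<and> edom h \<noteq> {} \<and> closed (epi h) \<and> convex (epi h)"

section \<open>Symmetric positive definite matrices\<close>

definition sym_pos_def :: "real^'n^'n \<Rightarrow> bool" where
  "sym_pos_def M \<longleftrightarrow> transpose M = M \<and> (\<forall>v. v \<noteq> 0 \<longrightarrow> 0 < v \<bullet> (M *v v))"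

definition mnorm :: "real^'n^'n \<Rightarrow> real^'n \<Rightarrow> real" where
  "mnorm M v = sqrt (v \<bullet> (M *v v))"

definition lambda_min :: "real^'n^'n \<Rightarrow> real" where
  "lambda_min M = (LEAST l. \<exists>v. v \<noteq> 0 \<and> M *v v = l *\<^sub>R v)"

definition golden_ratio :: real where
  "golden_ratio = (1 + sqrt 5) / 2"

section \<open>The problem and its Lagrangian\<close>

definition Phi :: "('x \<Rightarrow> ereal) \<Rightarrow> ('w \<Rightarrow> ereal) \<Rightarrow> 'x \<Rightarrow> 'w \<Rightarrow> ereal" where
  "Phi g f x w = g x + f w"

definition residual :: "real^'q^'m \<Rightarrow> real^'p^'m \<Rightarrow> real^'m \<Rightarrow> real^'q \<Rightarrow> real^'p \<Rightarrow> real^'m" where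
  "residual A B b x w = A *v x + B *v w - b"

definition feasible :: "real^'q^'m \<Rightarrow> real^'p^'m \<Rightarrow> real^'m \<Rightarrow> ((real^'q) \<times> (real^'p)) set" where
  "feasible A B b = {(x, w). A *v x + B *v w = b}"

definition solution_set ::
  "(real^'q \<Rightarrow> ereal) \<Rightarrow> (real^'p \<Rightarrow> ereal) \<Rightarrow> real^'q^'m \<Rightarrow> real^'p^'m \<Rightarrow> real^'m
     \<Rightarrow> ((real^'q) \<times> (real^'p)) set" where
  "solution_set g f A B b =
     {(x, w). (x, w) \<in> feasible A B b \<and> (\<forall>(x', w')\<in>feasible A B b. Phi g f x w \<le> Phi g f x' w')}"

definition opt_val ::
  "(real^'q \<Rightarrow> ereal) \<Rightarrow> (real^'p \<Rightarrow> ereal) \<Rightarrow> real^'q^'m \<Rightarrow> real^'p^'m \<Rightarrow> real^'m \<Rightarrow> ereal" where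
  "opt_val g f A B b = (INF (x, w)\<in>feasible A B b. Phi g f x w)"

definition standing_assumption ::
  "(real^'q \<Rightarrow> ereal) \<Rightarrow> (real^'p \<Rightarrow> ereal) \<Rightarrow> real^'q^'m \<Rightarrow> real^'p^'m \<Rightarrow> real^'m \<Rightarrow> bool" where
  "standing_assumption g f A B b \<longleftrightarrow>
     solution_set g f A B b \<noteq> {} \<and>
     (\<exists>x\<in>rel_interior (edom g). \<exists>w\<in>rel_interior (edom f). A *v x + B *v w = b)"

definition Lagr ::
  "(real^'q \<Rightarrow> ereal) \<Rightarrow> (real^'p \<Rightarrow> ereal) \<Rightarrow> real^'q^'m \<Rightarrow> real^'p^'m \<Rightarrow> real^'m
     \<Rightarrow> real^'q \<Rightarrow> real^'p \<Rightarrow> real^'m \<Rightarrow> ereal" where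
  "Lagr g f A B b x w y = Phi g f x w + ereal (y \<bullet> residual A B b x w)"

definition aug_Lagr ::
  "(real^'q \<Rightarrow> ereal) \<Rightarrow> (real^'p \<Rightarrow> ereal) \<Rightarrow> real^'q^'m \<Rightarrow> real^'p^'m \<Rightarrow> real^'m
     \<Rightarrow> real \<Rightarrow> real^'q \<Rightarrow> real^'p \<Rightarrow> real^'m \<Rightarrow> ereal" where
  "aug_Lagr g f A B b s x w y =
     Lagr g f A B b x w y + ereal (s / 2 * (norm (residual A B b x w))\<^sup>2)"

definition saddle_point ::
  "(real^'q \<Rightarrow> ereal) \<Rightarrow> (real^'p \<Rightarrow> ereal) \<Rightarrow> real^'q^'m \<Rightarrow> real^'p^'m \<Rightarrow> real^'m
     \<Rightarrow> real^'q \<Rightarrow> real^'p \<Rightarrow> real^'m \<Rightarrow> bool" where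
  "saddle_point g f A B b xs ws ys \<longleftrightarrow>
     (\<forall>x w y. Lagr g f A B b xs ws y \<le> Lagr g f A B b xs ws ys \<and>
              Lagr g f A B b xs ws ys \<le> Lagr g f A B b x w ys)"

section \<open>The algorithm\<close>

text \<open>Objective of the \<open>x\<close>-subproblem: the Lagrangian plus the proximal term, without the
  summand \<open>f w\<close>, which does not depend on the minimization variable. If \<open>f w\<close> is finite, this
  does not change the minimizers (lemma \<open>is_arg_min_x_objective_iff\<close> below). It matters only
  in the first iteration, since the starting point \<open>w 0\<close> is arbitrary: if it lies outside the
  domain of \<open>f\<close>, the full Lagrangian is identically infinite in \<open>x\<close>.\<close>

definition x_objective ::
  "(real^'q \<Rightarrow> ereal) \<Rightarrow> real^'q^'m \<Rightarrow> real^'p^'m \<Rightarrow> real^'m \<Rightarrow> real^'q^'q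
     \<Rightarrow> real \<Rightarrow> real^'q \<Rightarrow> real^'p \<Rightarrow> real^'m \<Rightarrow> real^'q \<Rightarrow> ereal" where
  "x_objective g A B b S t u w y x =
     g x + ereal (y \<bullet> residual A B b x w) + ereal (1 / (2 * t) * (mnorm S (x - u))\<^sup>2)"

lemma is_arg_min_x_objective_iff:
  assumes "\<bar>f w\<bar> \<noteq> \<infinity>"
  shows "is_arg_min (x_objective g A B b S t u w y) (\<lambda>_. True) x \<longleftrightarrow>
         is_arg_min (\<lambda>x. Lagr g f A B b x w y + ereal (1 / (2 * t) * (mnorm S (x - u))\<^sup>2))
           (\<lambda>_. True) x"
proof -
  have eq: "Lagr g f A B b z w y + ereal (1 / (2 * t) * (mnorm S (z - u))\<^sup>2)
      = f w + x_objective g A B b S t u w y z" for z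
    by (simp add: Lagr_def Phi_def x_objective_def ac_simps)
  have "f w + s < f w + t \<longleftrightarrow> s < t" for s t
    using assms by (cases "f w"; cases s; cases t) auto
  then show ?thesis
    by (simp only: is_arg_min_def eq)
qed

definition w_objective ::
  "(real^'q \<Rightarrow> ereal) \<Rightarrow> (real^'p \<Rightarrow> ereal) \<Rightarrow> real^'q^'m \<Rightarrow> real^'p^'m \<Rightarrow> real^'m \<Rightarrow> real^'p^'p
     \<Rightarrow> real \<Rightarrow> real^'q \<Rightarrow> real^'p \<Rightarrow> real^'m \<Rightarrow> real^'p \<Rightarrow> ereal" where
  "w_objective g f A B b T s x w' y w =
     aug_Lagr g f A B b s x w y + ereal (1 / (2 * s) * (mnorm T (w - w'))\<^sup>2)"

definition alg_params ::
  "real^'q^'q \<Rightarrow> real^'p^'p \<Rightarrow> real \<Rightarrow> real \<Rightarrow> real \<Rightarrow> real \<Rightarrow> real \<Rightarrow> real \<Rightarrow> (nat \<Rightarrow> real) \<Rightarrow> bool" where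
  "alg_params S T \<tau>0 \<beta> \<psi> \<rho> r1 r \<xi> \<longleftrightarrow>
     sym_pos_def S \<and> sym_pos_def T \<and> 0 < \<tau>0 \<and> 0 < \<beta> \<and>
     1 < \<psi> \<and> \<psi> < golden_ratio \<and> 1 \<le> \<rho> \<and> \<rho> \<le> 1 / \<psi> + 1 / \<psi>\<^sup>2 \<and>
     0 < r1 \<and> r1 < r \<and> r < \<rho> / 2 \<and>
     (\<forall>k. 1 < \<rho> + \<xi> k) \<and> summable (\<lambda>k. ln (\<rho> + \<xi> (Suc k)))"

definition L_ratio :: "real^'q^'m \<Rightarrow> (nat \<Rightarrow> real^'q) \<Rightarrow> nat \<Rightarrow> real" where
  "L_ratio A x k = norm (A *v x k - A *v x (k - 1)) / norm (x k - x (k - 1))"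

text \<open>The values \<open>x 0\<close>, \<open>w 0\<close>, \<open>y 0\<close> and \<open>\<tau> 0\<close> are the starting data; \<open>\<sigma> 0\<close> plays no role.\<close>

definition algorithm ::
  "(real^'q \<Rightarrow> ereal) \<Rightarrow> (real^'p \<Rightarrow> ereal) \<Rightarrow> real^'q^'m \<Rightarrow> real^'p^'m \<Rightarrow> real^'m
     \<Rightarrow> real^'q^'q \<Rightarrow> real^'p^'p \<Rightarrow> real \<Rightarrow> real \<Rightarrow> real \<Rightarrow> real \<Rightarrow> real \<Rightarrow> (nat \<Rightarrow> real)
     \<Rightarrow> (nat \<Rightarrow> real^'q) \<Rightarrow> (nat \<Rightarrow> real^'q) \<Rightarrow> (nat \<Rightarrow> real^'p) \<Rightarrow> (nat \<Rightarrow> real^'m)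
     \<Rightarrow> (nat \<Rightarrow> real) \<Rightarrow> (nat \<Rightarrow> real) \<Rightarrow> bool" where
  "algorithm g f A B b S T \<beta> \<psi> \<rho> r1 r \<xi> u x w y \<tau> \<sigma> \<longleftrightarrow>
     alg_params S T (\<tau> 0) \<beta> \<psi> \<rho> r1 r \<xi> \<and>
     u 0 = x 0 \<and>
     (\<forall>k\<ge>1.
        u k = ((\<psi> - 1) / \<psi>) *\<^sub>R x (k - 1) + (1 / \<psi>) *\<^sub>R u (k - 1) \<and>
        is_arg_min (x_objective g A B b S (\<tau> (k - 1)) (u k) (w (k - 1)) (y (k - 1)))
          (\<lambda>_. True) (x k) \<and>
        \<tau> k = (if x k \<noteq> x (k - 1) \<and>
                  \<tau> (k - 1) * L_ratio A x k > r * sqrt (lambda_min S) / sqrt \<beta>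
                then r1 * sqrt (lambda_min S) / (sqrt \<beta> * L_ratio A x k)
                else (\<rho> + \<xi> (k - 1)) * \<tau> (k - 1)) \<and>
        \<sigma> k = \<beta> * \<tau> k \<and>
        is_arg_min (w_objective g f A B b T (\<sigma> k) (x k) (w (k - 1)) (y (k - 1)))
          (\<lambda>_. True) (w k) \<and>
        y k = y (k - 1) + \<sigma> k *\<^sub>R residual A B b (x k) (w k))"

text \<open>The iterates are indexed from 1 and the estimate involves \<open>k - 1\<close>, hence the condition
  \<open>1 \<le> K\<close>.\<close>

definition estimate_index ::
  "(real^'q \<Rightarrow> ereal) \<Rightarrow> (real^'p \<Rightarrow> ereal) \<Rightarrow> real^'q^'m \<Rightarrow> real^'p^'m \<Rightarrow> real^'m
     \<Rightarrow> real^'q^'q \<Rightarrow> real^'p^'p \<Rightarrow> real \<Rightarrow> real \<Rightarrow> real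
     \<Rightarrow> (nat \<Rightarrow> real^'q) \<Rightarrow> (nat \<Rightarrow> real^'q) \<Rightarrow> (nat \<Rightarrow> real^'p) \<Rightarrow> (nat \<Rightarrow> real^'m)
     \<Rightarrow> (nat \<Rightarrow> real) \<Rightarrow> real^'q \<Rightarrow> real^'p \<Rightarrow> nat \<Rightarrow> bool" where
  "estimate_index g f A B b S T \<beta> \<psi> \<rho> u x w y \<tau> xb wb K \<longleftrightarrow> 1 \<le> K \<and>
     (\<forall>k\<ge>K. \<forall>v.
        ereal (2 * \<tau> k) * (Lagr g f A B b (x k) (w k) v - opt_val g f A B b) \<le>
        ereal (\<psi> / (\<psi> - 1) * ((mnorm S (u (k + 1) - xb))\<^sup>2 - (mnorm S (u (k + 2) - xb))\<^sup>2)
          + 1 / \<beta> * ((mnorm T (wb - w (k - 1)))\<^sup>2 - (mnorm T (wb - w k))\<^sup>2)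
          + 1 / \<beta> * ((norm (v - y (k - 1)))\<^sup>2 - (norm (v - y k))\<^sup>2)
          - 1 / \<beta> * (mnorm T (w k - w (k - 1)))\<^sup>2
          - 1 / \<beta> * (1 - \<rho> / 2) * (norm (y k - y (k - 1)))\<^sup>2
          - \<psi> * \<tau> k / \<tau> (k - 1) * (mnorm S (x k - u (k + 1)))\<^sup>2))"

definition ergodic_mean :: "nat \<Rightarrow> (nat \<Rightarrow> 'a::real_vector) \<Rightarrow> nat \<Rightarrow> 'a" where
  "ergodic_mean K z N = (1 / (real N - real K + 1)) *\<^sub>R (\<Sum>k=K..N. z k)"

end

theory Submission
  imports Defs
begin

text \<open>Two proximal inequalities for \<open>x\<close> and one for \<open>w\<close> combine, through the golden ratio relation
  between \<open>x\<close> and \<open>u\<close>, into a one-step estimate in which an energy telescopes. The coupling term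
  \<open>\<langle>y\<^sub>k\<^sub>-\<^sub>1 - y\<^sub>k, A (x\<^sub>k\<^sub>+\<^sub>1 - x\<^sub>k)\<rangle>\<close> is absorbed as soon as the step size is no longer reduced. This happens
  only finitely often: step sizes are bounded below, each reduction divides by at least \<open>r / r1 > 1\<close>,
  and the product of all growth factors is finite.

  For a saddle point the energy is eventually decreasing, so successive differences vanish, every
  cluster point is a saddle point, and the energy relative to a cluster point tends to zero. For the
  ergodic rate, the estimate is summed with a multiplier \<open>v\<close> parallel to the residual of the means and
  of norm \<open>\<parallel>yb\<parallel> + 1\<close>, which exceeds the possible decrease of the objective below the optimal value.\<close>

section \<open>Positive definite matrices\<close>

lemma inner_matrix_swap:
  assumes "sym_pos_def M"
  shows "v \<bullet> (M *v z) = z \<bullet> (M *v v)"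
proof -
  have "v \<bullet> (M *v z) = (transpose M *v v) \<bullet> z"
    by (simp only: dot_lmul_matrix transpose_matrix_vector)
  also have "\<dots> = (M *v v) \<bullet> z"
    using assms by (simp only: sym_pos_def_def)
  finally show ?thesis
    by (simp add: inner_commute)
qed

lemma mnorm_sq:
  assumes "sym_pos_def M"
  shows "(mnorm M v)\<^sup>2 = v \<bullet> (M *v v)"
proof -
  have "0 \<le> v \<bullet> (M *v v)"
    using assms by (cases "v = 0") (auto simp: sym_pos_def_def less_imp_le)
  then show ?thesis
    by (simp add: mnorm_def)
qed

text \<open>\<open>lambda_min\<close> is a \<open>LEAST\<close> over the reals, so its existence has
  to be shown. A minimizer of the quadratic form on the compact unit sphere is an eigenvector, and
  its value bounds every eigenvalue from below.\<close>

lemma lambda_min_rayleigh: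
  assumes M: "sym_pos_def (M :: real^'n^'n)"
  shows "0 < lambda_min M" and "lambda_min M * (norm v)\<^sup>2 \<le> v \<bullet> (M *v v)"
proof -
  let ?q = "\<lambda>v. v \<bullet> (M *v v)"
  have "continuous_on (sphere 0 1) ?q"
    by (intro continuous_intros linear_continuous_on matrix_vector_mul_bounded_linear)
  moreover have "sphere (0 :: real^'n) 1 \<noteq> {}"
    by simp
  ultimately obtain e where e: "norm e = 1" and min: "\<And>z. norm z = 1 \<Longrightarrow> ?q e \<le> ?q z"
    using continuous_attains_inf[of "sphere 0 1" ?q] by auto
  define l where "l = ?q e"
  have l_pos: "0 < l"
    using M e unfolding l_def sym_pos_def_def by (metis norm_zero zero_neq_one)
  have bound: "l * (norm z)\<^sup>2 \<le> ?q z" for z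
  proof (cases "z = 0")
    case False
    have "l \<le> ?q ((1 / norm z) *\<^sub>R z)"
      unfolding l_def by (rule min) (use False in simp)
    also have "\<dots> = ?q z / (norm z)\<^sup>2"
      by (simp add: matrix_vector_mult_scaleR power2_eq_square)
    finally show ?thesis
      using False by (simp add: pos_le_divide_eq)
  qed simp
  \<comment> \<open>First-order condition at the minimizer: \<open>bound\<close> at
    \<open>e + t *\<^sub>R z\<close> says that a quadratic polynomial in \<open>t\<close> without
    constant term is nowhere negative, so its linear coefficient vanishes.\<close>
  have "z \<bullet> (M *v e - l *\<^sub>R e) = 0" for z
  proof -
    let ?c = "z \<bullet> (M *v e - l *\<^sub>R e)" and ?d = "?q z - l * (norm z)\<^sup>2"
    have quad: "0 \<le> 2 * t * ?c + t\<^sup>2 * ?d" for t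
    proof -
      have "?q (e + t *\<^sub>R z) = l + 2 * t * (z \<bullet> (M *v e)) + t\<^sup>2 * ?q z"
        by (simp add: matrix_vector_mult_scaleR matrix_vector_right_distrib inner_add_left
            inner_add_right inner_matrix_swap[OF M, of e z] l_def power2_eq_square algebra_simps)
      moreover have "(norm (e + t *\<^sub>R z))\<^sup>2 = 1 + 2 * t * (z \<bullet> e) + t\<^sup>2 * (norm z)\<^sup>2"
        using e unfolding power2_norm_eq_inner norm_eq_1
        by (simp add: inner_add_left inner_add_right inner_commute power2_eq_square algebra_simps)
      ultimately show ?thesis
        using bound[of "e + t *\<^sub>R z"] by (simp add: inner_diff_right algebra_simps)
    qed
    have d: "0 \<le> ?d"
      using bound[of z] by simp
    \<comment> \<open>The vertex of the parabola would be \<open>- ?c / ?d\<close>; the denominator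
      \<open>?d + 1\<close> also serves when \<open>?d = 0\<close>.\<close>
    have "0 \<le> 2 * (- ?c / (?d + 1)) * ?c + (- ?c / (?d + 1))\<^sup>2 * ?d"
      by (rule quad)
    also have "\<dots> = - (?c\<^sup>2 * (?d + 2)) / (?d + 1)\<^sup>2"
      using d by (simp add: divide_simps power2_eq_square) (simp add: algebra_simps)
    finally have "?c\<^sup>2 * (?d + 2) \<le> 0"
      using d by (simp add: divide_simps)
    then show ?thesis
      using d by (simp add: mult_le_0_iff)
  qed
  then have eig: "M *v e = l *\<^sub>R e"
    by (metis inner_eq_zero_iff eq_iff_diff_eq_0)
  have "lambda_min M = l"
    unfolding lambda_min_def
  proof (rule Least_equality)
    show "\<exists>v. v \<noteq> 0 \<and> M *v v = l *\<^sub>R v"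
      using eig e by (metis norm_zero zero_neq_one)
  next
    fix l' assume "\<exists>v. v \<noteq> 0 \<and> M *v v = l' *\<^sub>R v"
    then obtain z where z: "z \<noteq> 0" "M *v z = l' *\<^sub>R z"
      by auto
    then show "l \<le> l'"
      using bound[of z] by (simp flip: power2_norm_eq_inner)
  qed
  then show "0 < lambda_min M" and "lambda_min M * (norm v)\<^sup>2 \<le> v \<bullet> (M *v v)"
    using l_pos bound by auto
qed

lemma mnorm_sq_ge:
  assumes "sym_pos_def M"
  shows "lambda_min M * (norm v)\<^sup>2 \<le> (mnorm M v)\<^sup>2"
  using lambda_min_rayleigh(2)[OF assms] by (simp add: mnorm_sq[OF assms])

lemma mnorm_sq_tendsto_0_imp:
  assumes M: "sym_pos_def M" and lim: "(\<lambda>n. (mnorm M (v n))\<^sup>2) \<longlonglongrightarrow> 0"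
  shows "v \<longlonglongrightarrow> 0"
proof -
  have "(\<lambda>n. (norm (v n))\<^sup>2) \<longlonglongrightarrow> 0"
  proof (rule real_tendsto_sandwich)
    show "(\<lambda>n. 0 :: real) \<longlonglongrightarrow> 0"
      by simp
    show "\<forall>\<^sub>F n in sequentially. (norm (v n))\<^sup>2 \<le> (mnorm M (v n))\<^sup>2 / lambda_min M"
      using mnorm_sq_ge[OF M] lambda_min_rayleigh(1)[OF M]
      by (simp add: pos_le_divide_eq mult.commute)
    show "(\<lambda>n. (mnorm M (v n))\<^sup>2 / lambda_min M) \<longlonglongrightarrow> 0"
      using tendsto_divide[OF lim tendsto_const, of "lambda_min M"]
        lambda_min_rayleigh(1)[OF M] by simp
  qed auto
  then show ?thesis
    by (simp add: tendsto_norm_zero_iff)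
qed

section \<open>Quadratic identities for the norms induced by positive definite matrices\<close>

text \<open>Since \<open>x1 = (\<psi> / (\<psi> - 1)) u2 - (1 / (\<psi> - 1)) u1\<close>, the distance of \<open>x1\<close> to \<open>xb\<close> is expressed
  by those of \<open>u1\<close> and \<open>u2\<close>, which makes the right-hand side telescope.\<close>

lemma golden_step_identity:
  assumes S: "sym_pos_def S" and \<psi>: "1 < \<psi>"
    and u2: "u2 = ((\<psi> - 1) / \<psi>) *\<^sub>R x1 + (1 / \<psi>) *\<^sub>R u1"
  shows "2 * ((xb - x1) \<bullet> (S *v (x1 - u1))) + 2 * \<theta> * ((x1 - x0) \<bullet> (S *v (x0 - u1))) =
    \<psi> / (\<psi> - 1) * ((mnorm S (u1 - xb))\<^sup>2 - (mnorm S (u2 - xb))\<^sup>2)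
    - (1 + 1 / \<psi> - \<theta>) * (mnorm S (x1 - u1))\<^sup>2
    - \<theta> * (mnorm S (x0 - u1))\<^sup>2 - \<theta> * (mnorm S (x1 - x0))\<^sup>2"
proof -
  \<comment> \<open>In the variables \<open>a\<close>, \<open>p\<close>, \<open>c\<close>, with
    weight \<open>s\<close>, both sides are combinations of the same inner products, and expansion
    decides the identity.\<close>
  define a p c where "a = u1 - xb" and "p = x1 - u1" and "c = x0 - u1"
  define s where "s = (\<psi> - 1) / \<psi>"
  have eqs: "u2 - xb = a + s *\<^sub>R p"
  proof -
    have "1 / \<psi> = 1 - s"
      using \<psi> by (simp add: s_def field_simps)
    then show ?thesis
      unfolding u2 a_def p_def s_def[symmetric] by (simp only:) (simp add: algebra_simps)
  qed
  have eqs': "xb - x1 = - (a + p)" "x1 - x0 = p - c"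
    by (simp_all add: a_def p_def c_def)
  have s: "\<psi> / (\<psi> - 1) = 1 / s" "1 / \<psi> = 1 - s" "s \<noteq> 0"
    using \<psi> by (simp_all add: s_def field_simps)
  show ?thesis
    unfolding mnorm_sq[OF S] eqs eqs' a_def[symmetric] p_def[symmetric] c_def[symmetric] s(1,2)
    using s(3)
    by (simp add: matrix_vector_mult_scaleR matrix_vector_right_distrib matrix_vector_mult_diff_distrib
        inner_add_left inner_add_right inner_diff_left inner_diff_right
        inner_matrix_swap[OF S, of p a] inner_matrix_swap[OF S, of p c] field_simps)
qed

lemma three_point_identity:
  assumes T: "sym_pos_def T"
  shows "2 * ((z - b) \<bullet> (T *v (b - a))) =
    (mnorm T (z - a))\<^sup>2 - (mnorm T (z - b))\<^sup>2 - (mnorm T (b - a))\<^sup>2"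
  unfolding mnorm_sq[OF T]
  by (simp add: matrix_vector_mult_diff_distrib inner_diff_left inner_diff_right
      inner_matrix_swap[OF T, of a b] inner_matrix_swap[OF T, of z b]
      inner_matrix_swap[OF T, of z a])

lemma tendsto_matrix_vector_mult:
  fixes M :: "real^'n^'m"
  assumes "(v \<longlongrightarrow> l) F"
  shows "((\<lambda>n. M *v v n) \<longlongrightarrow> M *v l) F"
  by (rule bounded_linear.tendsto[OF matrix_vector_mul_bounded_linear assms])

text \<open>Supplies, for the proximal terms, the expansion along a line that
  \<open>arg_min_variational_ineq\<close> asks for.\<close>

lemma mnorm_sq_line:
  assumes M: "sym_pos_def M"
  shows "(mnorm M (v + t *\<^sub>R d))\<^sup>2 =
    (mnorm M v)\<^sup>2 + t * (2 * (d \<bullet> (M *v v))) + t\<^sup>2 * (mnorm M d)\<^sup>2"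
  unfolding mnorm_sq[OF M]
  by (simp add: matrix_vector_mult_scaleR matrix_vector_right_distrib inner_add_left inner_add_right
      inner_matrix_swap[OF M, of v d] power2_eq_square algebra_simps)

section \<open>Proximal inequalities and step sizes\<close>

text \<open>Optimality without subdifferential calculus: \<open>D\<close> is the directional
  derivative of the quadratic part \<open>q\<close> at the minimizer. Compare the minimizer with the
  points of the segment to \<open>z\<close>, use convexity of \<open>h\<close>, divide by
  \<open>t\<close> and let \<open>t\<close> tend to 0.\<close>

lemma arg_min_variational_ineq:
  fixes h :: "'a::euclidean_space \<Rightarrow> ereal"
  assumes h: "proper_closed_convex h"
    and min: "is_arg_min (\<lambda>z. h z + ereal (q z)) (\<lambda>_. True) x"
    and expand: "\<And>t d. q (x + t *\<^sub>R d) = q x + t * D d + t\<^sup>2 * Q d"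
  shows "x \<in> edom h" and "h x \<le> h z + ereal (D (z - x))"
proof -
  have le: "h x + ereal (q x) \<le> h z + ereal (q z)" for z
    using min by (auto simp: is_arg_min_def not_less)
  have nminf: "h z \<noteq> -\<infinity>" for z
    using h by (simp add: proper_closed_convex_def)
  obtain z0 where "h z0 < \<infinity>"
    using h by (auto simp: proper_closed_convex_def edom_def)
  then show x_dom: "x \<in> edom h"
    using le[of z0] by (cases "h x"; cases "h z0") (auto simp: edom_def)
  show "h x \<le> h z + ereal (D (z - x))"
  proof (cases "h z = \<infinity>")
    case False
    then obtain c where c: "h z = ereal c"
      using nminf[of z] by (cases "h z") auto
    obtain a where a: "h x = ereal a"
      using nminf[of x] x_dom by (cases "h x") (auto simp: edom_def)
    have ineq: "a \<le> c + D (z - x) + t * Q (z - x)" if t: "0 < t" "t < 1" for t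
    proof -
      have "(1 - t) *\<^sub>R (x, a) + t *\<^sub>R (z, c) \<in> epi h"
        using h t by (intro convexD) (auto simp: proper_closed_convex_def epi_def a c)
      moreover have "(1 - t) *\<^sub>R x + t *\<^sub>R z = x + t *\<^sub>R (z - x)"
        by (simp add: algebra_simps)
      ultimately have "h (x + t *\<^sub>R (z - x)) \<le> ereal ((1 - t) * a + t * c)"
        by (simp add: epi_def)
      then have "h x + ereal (q x) \<le> ereal ((1 - t) * a + t * c) + ereal (q (x + t *\<^sub>R (z - x)))"
        using le[of "x + t *\<^sub>R (z - x)"] by (meson add_right_mono order_trans)
      then have "a + q x \<le> (1 - t) * a + t * c + q (x + t *\<^sub>R (z - x))"
        by (simp add: a)
      then have "t * a \<le> t * (c + D (z - x) + t * Q (z - x))"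
        by (simp only: expand power2_eq_square) (simp only: algebra_simps)
      then show ?thesis
        using t by simp
    qed
    have "((\<lambda>t. c + D (z - x) + t * Q (z - x)) \<longlongrightarrow> c + D (z - x) + 0 * Q (z - x)) (at_right 0)"
      by (intro tendsto_intros)
    moreover have "\<forall>\<^sub>F t in at_right 0. a \<le> c + D (z - x) + t * Q (z - x)"
      using ineq by (auto simp: eventually_at_right_field intro!: exI[of _ 1])
    ultimately have "a \<le> c + D (z - x) + 0 * Q (z - x)"
      by (rule tendsto_lowerbound) simp
    then show ?thesis
      by (simp add: a c)
  qed simp
qed

text \<open>In the application \<open>c\<close> is \<open>scale\<close>, \<open>L k\<close> is
  \<open>L_ratio A x k\<close> and \<open>a k\<close> is \<open>\<rho> + \<xi> k\<close>. A reduced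
  step size is \<open>r1 * c / L (Suc k)\<close> with \<open>L\<close> bounded above, and every
  other step increases \<open>\<tau>\<close>; this yields the lower bound.\<close>

lemma adaptive_stepsize:
  fixes \<tau> L a :: "nat \<Rightarrow> real"
  assumes r: "0 < r1" "r1 < r" and c: "0 < c" and \<tau>0: "0 < \<tau> 0"
    and L: "\<And>k. L k \<le> M"
    and a: "\<And>k. 1 < a k" and a_sum: "summable (\<lambda>k. ln (a (Suc k)))"
    and step: "\<And>k. \<tau> (Suc k) = (if \<tau> k * L (Suc k) > r * c then r1 * c / L (Suc k) else a k * \<tau> k)"
  shows "\<exists>\<delta>>0. \<forall>k. \<delta> \<le> \<tau> k"
    and "\<forall>\<^sub>F k in sequentially. \<tau> k * L (Suc k) \<le> r * c"
    and "a \<longlonglongrightarrow> 1"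
proof -
  have pos: "0 < \<tau> k" for k
  proof (induction k)
    case (Suc k)
    have "0 < L (Suc k)" if "\<tau> k * L (Suc k) > r * c"
    proof -
      have "0 < \<tau> k * L (Suc k)"
        using that r c by (smt (verit) mult_pos_pos)
      then show ?thesis
        using Suc by (simp add: zero_less_mult_iff)
    qed
    then show ?case
      using r c a[of k] Suc by (simp add: step)
  qed (rule \<tau>0)
  have L_pos: "0 < L (Suc k)" if "\<tau> k * L (Suc k) > r * c" for k
  proof -
    have "0 < \<tau> k * L (Suc k)"
      using that r c by (smt (verit) mult_pos_pos)
    then show ?thesis
      using pos[of k] by (simp add: zero_less_mult_iff)
  qed
  \<comment> \<open>The second entry is a lower bound for every reduced step size;
    \<open>max M 1\<close> keeps it positive whatever the sign of \<open>M\<close>.\<close>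
  define \<delta> where "\<delta> = min (\<tau> 0) (r1 * c / max M 1)"
  have \<delta>_pos: "0 < \<delta>"
    using \<tau>0 r c by (simp add: \<delta>_def)
  have \<delta>: "\<delta> \<le> \<tau> k" for k
  proof (induction k)
    case (Suc k)
    have "\<delta> \<le> r1 * c / L (Suc k)" if "\<tau> k * L (Suc k) > r * c"
    proof -
      have "r1 * c / max M 1 \<le> r1 * c / L (Suc k)"
        using L_pos[OF that] L[of "Suc k"] r c by (intro divide_left_mono) auto
      then show ?thesis
        by (simp add: \<delta>_def)
    qed
    moreover have "\<delta> \<le> a k * \<tau> k"
      using Suc a[of k] pos[of k] by (smt (verit) mult_le_cancel_right1)
    ultimately show ?case
      by (simp add: step)
  qed (simp add: \<delta>_def)
  then show "\<exists>\<delta>>0. \<forall>k. \<delta> \<le> \<tau> k"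
    using \<delta>_pos by blast
  have sum: "summable (\<lambda>k. ln (a k))"
    using a_sum summable_Suc_iff[of "\<lambda>k. ln (a k)"] by simp
  have ln_pos: "0 < ln (a k)" for k
    using a[of k] by simp
  show "a \<longlonglongrightarrow> 1"
  proof -
    have "(\<lambda>k. exp (ln (a k))) \<longlonglongrightarrow> exp 0"
      by (intro tendsto_intros summable_LIMSEQ_zero sum)
    moreover have "exp (ln (a k)) = a k" for k
      using a[of k] by simp
    ultimately show ?thesis
      by simp
  qed
  \<comment> \<open>The growth factors have a finite product, so the part of \<open>ln \<tau>\<close> they do not explain decreases;
    each reduction of the step size lowers it by at least \<open>ln (r / r1)\<close>.\<close>
  define V where "V k = ln (\<tau> k) - (\<Sum>j<k. ln (a j))" for k
  have V_first: "V (Suc k) \<le> V k - ln (r / r1)" if "\<tau> k * L (Suc k) > r * c" for k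
  proof -
    have "r1 * c / L (Suc k) \<le> (r1 / r) * \<tau> k"
      using L_pos[OF that] that r by (simp add: divide_simps) (simp add: mult_ac)
    then have "ln (\<tau> (Suc k)) \<le> ln ((r1 / r) * \<tau> k)"
      using that pos[of "Suc k"] by (simp add: step)
    also have "\<dots> = ln (\<tau> k) - ln (r / r1)"
      using r pos[of k] by (simp add: ln_mult ln_div)
    finally show ?thesis
      using ln_pos[of k] by (simp add: V_def)
  qed
  have V_other: "V (Suc k) = V k" if "\<not> \<tau> k * L (Suc k) > r * c" for k
    using that pos[of k] a[of k] by (simp add: V_def step ln_mult)
  have ratio: "0 < ln (r / r1)"
    using r by simp
  have "decseq V"
    unfolding decseq_Suc_iff using V_first V_other ratio by (smt (verit))
  moreover have "ln \<delta> - (\<Sum>j. ln (a j)) \<le> V k" for k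
  proof -
    have "ln \<delta> \<le> ln (\<tau> k)"
      using \<delta>[of k] \<delta>_pos by simp
    moreover have "(\<Sum>j<k. ln (a j)) \<le> (\<Sum>j. ln (a j))"
      using sum ln_pos by (intro sum_le_suminf) (auto intro: less_imp_le)
    ultimately show ?thesis
      by (simp add: V_def)
  qed
  ultimately obtain l where "V \<longlonglongrightarrow> l"
    using decseq_convergent by blast
  \<comment> \<open>Consecutive values of the convergent \<open>V\<close> eventually differ by less
    than \<open>ln (r / r1)\<close>, the drop that each reduction forces.\<close>
  then have "(\<lambda>k. V k - V (Suc k)) \<longlonglongrightarrow> l - l"
    by (intro tendsto_diff LIMSEQ_Suc)
  then have "\<forall>\<^sub>F k in sequentially. V k - V (Suc k) < ln (r / r1)"
    using ratio by (intro order_tendstoD(2)) auto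
  then show "\<forall>\<^sub>F k in sequentially. \<tau> k * L (Suc k) \<le> r * c"
    by eventually_elim (use V_first in \<open>force simp: not_le[symmetric]\<close>)
qed

section \<open>Convex functions and saddle points\<close>

lemma residual_line_x: "residual A B b (x + t *\<^sub>R d) w = residual A B b x w + t *\<^sub>R (A *v d)"
  by (simp add: residual_def matrix_vector_mult_scaleR matrix_vector_right_distrib)

lemma residual_line_w: "residual A B b x (w + t *\<^sub>R d) = residual A B b x w + t *\<^sub>R (B *v d)"
  by (simp add: residual_def matrix_vector_mult_scaleR matrix_vector_right_distrib)

lemma residual_diff:
  "residual A B b x w - residual A B b x' w' = A *v (x - x') + B *v (w - w')"
  by (simp add: residual_def matrix_vector_mult_diff_distrib)

lemma pcc_ereal:
  assumes "proper_closed_convex h" "z \<in> edom h"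
  shows "h z = ereal (real_of_ereal (h z))"
  using assms by (cases "h z") (auto simp: proper_closed_convex_def edom_def)

text \<open>The epigraph is closed. The varying bound \<open>c n\<close> allows the right-hand sides
  of the proximal inequalities to pass to the limit together with \<open>z n\<close>.\<close>

lemma pcc_lower_semicontinuous:
  assumes h: "proper_closed_convex h" and z: "z \<longlonglongrightarrow> l" and c: "c \<longlonglongrightarrow> d"
    and le: "\<And>n :: nat. h (z n) \<le> ereal (c n)"
  shows "h l \<le> ereal d"
proof -
  have "(\<lambda>n. (z n, c n)) \<longlonglongrightarrow> (l, d)"
    using z c by (rule tendsto_Pair)
  moreover have "(z n, c n) \<in> epi h" for n
    using le by (simp add: epi_def)
  ultimately have "(l, d) \<in> epi h"
    using h closed_sequentially[of "epi h" "\<lambda>n. (z n, c n)"]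
    by (simp add: proper_closed_convex_def)
  then show ?thesis
    by (simp add: epi_def)
qed

section \<open>Ergodic means and saddle points\<close>

lemma ergodic_mean_eq_sum:
  assumes "K \<le> N"
  shows "ergodic_mean K z N = (\<Sum>k=K..N. (1 / real (card {K..N})) *\<^sub>R z k)"
  using assms by (simp add: ergodic_mean_def scaleR_sum_right of_nat_diff algebra_simps)

text \<open>Jensen's inequality, read off from a convex combination of points of the epigraph, which
  avoids arithmetic with infinite values.\<close>

lemma pcc_ergodic_mean_le:
  assumes h: "proper_closed_convex h" and z: "\<And>k. k \<in> {K..N} \<Longrightarrow> z k \<in> edom h" and "K \<le> N"
  shows "h (ergodic_mean K z N) \<le> ereal (ergodic_mean K (\<lambda>k. real_of_ereal (h (z k))) N)"
proof -
  have "(\<Sum>k=K..N. (1 / real (card {K..N})) *\<^sub>R (z k, real_of_ereal (h (z k)))) \<in> epi h"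
  proof (rule convex_sum)
    show "(z k, real_of_ereal (h (z k))) \<in> epi h" if "k \<in> {K..N}" for k
      using pcc_ereal[OF h z[OF that]] unfolding epi_def by (metis case_prod_conv mem_Collect_eq order_refl)
  qed (use h \<open>K \<le> N\<close> in \<open>auto simp: proper_closed_convex_def\<close>)
  then show ?thesis
    using \<open>K \<le> N\<close> by (simp add: epi_def ergodic_mean_eq_sum fst_sum snd_sum sum_prod)
qed

text \<open>The residual is affine and the weights add up to 1, so the constant \<open>b\<close> is
  its own mean.\<close>

lemma residual_ergodic_mean:
  assumes "K \<le> N"
  shows "residual A B b (ergodic_mean K x N) (ergodic_mean K w N) =
    ergodic_mean K (\<lambda>k. residual A B b (x k) (w k)) N"
proof -
  have "real N - real K + 1 = real (card {K..N})" "card {K..N} \<noteq> 0"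
    using assms by (simp_all add: of_nat_diff)
  then have b: "ergodic_mean K (\<lambda>_. b) N = b"
    by (simp add: ergodic_mean_def sum_constant_scaleR del: sum_constant card_atLeastAtMost)
  have "residual A B b (ergodic_mean K x N) (ergodic_mean K w N) =
      A *v ergodic_mean K x N + B *v ergodic_mean K w N - ergodic_mean K (\<lambda>_. b) N"
    by (simp only: residual_def b)
  also have "\<dots> = ergodic_mean K (\<lambda>k. residual A B b (x k) (w k)) N"
    by (simp add: ergodic_mean_def residual_def sum.distrib sum_subtractf scaleR_add_right
        scaleR_diff_right matrix_vector_mult_scaleR linear_sum[OF matrix_vector_mul_linear]
        del: sum_constant)
  finally show ?thesis .
qed

text \<open>Turns the extended-valued saddle inequalities into real ones. Properness makes the
  saddle value finite, and the Lagrangian, being affine in the multiplier, has a maximum over all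
  multipliers only where the residual vanishes.\<close>

lemma saddle_point_imp:
  assumes g: "proper_closed_convex g" and f: "proper_closed_convex f"
    and saddle: "saddle_point g f A B b xb wb yb"
  shows "xb \<in> edom g" "wb \<in> edom f" "residual A B b xb wb = 0"
    and "opt_val g f A B b = ereal (real_of_ereal (g xb) + real_of_ereal (f wb))"
    and "\<And>x w. x \<in> edom g \<Longrightarrow> w \<in> edom f \<Longrightarrow>
      real_of_ereal (g xb) + real_of_ereal (f wb)
        \<le> real_of_ereal (g x) + real_of_ereal (f w) + yb \<bullet> residual A B b x w"
proof -
  have up: "Lagr g f A B b xb wb y \<le> Lagr g f A B b xb wb yb"
    and low: "Lagr g f A B b xb wb yb \<le> Lagr g f A B b x w yb" for x w y
    using saddle by (auto simp: saddle_point_def)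
  obtain x0 w0 where "x0 \<in> edom g" "w0 \<in> edom f"
    using g f by (auto simp: proper_closed_convex_def)
  then have "Lagr g f A B b x0 w0 yb < \<infinity>"
    using pcc_ereal[OF g, of x0] pcc_ereal[OF f, of w0]
    by (cases "g x0"; cases "f w0") (auto simp: Lagr_def Phi_def)
  then have "Lagr g f A B b xb wb yb < \<infinity>"
    using low[of x0 w0] by (meson order_le_less_trans)
  moreover have "g xb \<noteq> -\<infinity>" "f wb \<noteq> -\<infinity>"
    using g f by (auto simp: proper_closed_convex_def)
  ultimately show xb: "xb \<in> edom g" and wb: "wb \<in> edom f"
    by (cases "g xb"; cases "f wb"; simp add: Lagr_def Phi_def edom_def)+
  obtain gb fb where eqs: "g xb = ereal gb" "f wb = ereal fb"
    using pcc_ereal[OF g xb] pcc_ereal[OF f wb] by blast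
  have "y \<bullet> residual A B b xb wb \<le> yb \<bullet> residual A B b xb wb" for y
    using up[of y] by (simp add: Lagr_def Phi_def eqs)
  \<comment> \<open>Moving the multiplier along the residual would raise the Lagrangian by the
    squared norm of the residual.\<close>
  from this[of "yb + residual A B b xb wb"]
  have "residual A B b xb wb \<bullet> residual A B b xb wb \<le> 0"
    by (simp only: inner_add_left)
  then show res: "residual A B b xb wb = 0"
    by (metis inner_gt_zero_iff not_le)
  have Lagr_eq: "Lagr g f A B b xb wb yb = ereal (real_of_ereal (g xb) + real_of_ereal (f wb))"
    by (simp add: Lagr_def Phi_def eqs res)
  show "opt_val g f A B b = ereal (real_of_ereal (g xb) + real_of_ereal (f wb))"
    unfolding opt_val_def
  proof (rule antisym)
    have "(xb, wb) \<in> feasible A B b"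
      using res by (simp add: feasible_def residual_def)
    then show "(INF (x, w)\<in>feasible A B b. Phi g f x w)
        \<le> ereal (real_of_ereal (g xb) + real_of_ereal (f wb))"
      by (rule INF_lower2) (simp add: Phi_def eqs)
    have "Lagr g f A B b x w yb = Phi g f x w" if "(x, w) \<in> feasible A B b" for x w
      using that by (simp add: Lagr_def feasible_def residual_def flip: zero_ereal_def)
    then show "ereal (real_of_ereal (g xb) + real_of_ereal (f wb))
        \<le> (INF (x, w)\<in>feasible A B b. Phi g f x w)"
      using low unfolding Lagr_eq by (auto intro!: INF_greatest) metis
  qed
  show "real_of_ereal (g xb) + real_of_ereal (f wb)
        \<le> real_of_ereal (g x) + real_of_ereal (f w) + yb \<bullet> residual A B b x w"
    if xw: "x \<in> edom g" "w \<in> edom f" for x w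
  proof -
    obtain c d where "g x = ereal c" "f w = ereal d"
      using pcc_ereal[OF g xw(1)] pcc_ereal[OF f xw(2)] by blast
    then show ?thesis
      using low[of x w] unfolding Lagr_eq by (simp add: Lagr_def Phi_def)
  qed
qed

text \<open>The first two hypotheses say that the negatives of \<open>transpose A *v ys\<close> and
  \<open>transpose B *v ys\<close> are subgradients of \<open>g\<close> and \<open>f\<close>. For a
  feasible pair they add up to the saddle inequality.\<close>

lemma saddle_pointI:
  assumes g: "\<And>z. g xs \<le> g z + ereal (ys \<bullet> (A *v (z - xs)))"
    and f: "\<And>z. f ws \<le> f z + ereal (ys \<bullet> (B *v (z - ws)))"
    and res: "residual A B b xs ws = 0"
  shows "saddle_point g f A B b xs ws ys"
proof -
  have "Phi g f xs ws \<le> Lagr g f A B b x w ys" for x w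
  proof -
    have "residual A B b x w = A *v (x - xs) + B *v (w - ws)"
      using residual_diff[of A B b x w xs ws] by (simp add: res)
    then have "Lagr g f A B b x w ys =
        (g x + ereal (ys \<bullet> (A *v (x - xs)))) + (f w + ereal (ys \<bullet> (B *v (w - ws))))"
      by (simp add: Lagr_def Phi_def inner_add_right ac_simps flip: plus_ereal.simps(1))
    then show ?thesis
      unfolding Phi_def using add_mono[OF g f] by simp
  qed
  then show ?thesis
    by (simp add: saddle_point_def Lagr_def res flip: zero_ereal_def)
qed

section \<open>The one-step estimate\<close>

text \<open>The golden ratio is the positive root of \<open>t\<^sup>2 = t + 1\<close>. The strict
  inequality leaves room for growth factors that tend to 1.\<close>

lemma golden_ratio_bound:
  assumes "0 < \<psi>" "\<psi> < golden_ratio"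
  shows "1 < 1 / \<psi> + 1 / \<psi>\<^sup>2"
proof -
  have "\<psi>\<^sup>2 < \<psi> + 1"
  proof (cases "2 * \<psi> - 1 \<le> 0")
    case True
    then have "\<psi> * \<psi> \<le> \<psi> * 1"
      using assms(1) by (intro mult_left_mono) auto
    then show ?thesis
      by (simp add: power2_eq_square)
  next
    case False
    have "2 * \<psi> - 1 < sqrt 5"
      using assms(2) by (simp add: golden_ratio_def)
    then have "(2 * \<psi> - 1)\<^sup>2 < (sqrt 5)\<^sup>2"
      using False by (intro power_strict_mono) auto
    then show ?thesis
      by (simp add: power2_eq_square algebra_simps)
  qed
  then have "1 < (\<psi> + 1) / \<psi>\<^sup>2"
    using assms(1) by simp
  also have "\<dots> = 1 / \<psi> + 1 / \<psi>\<^sup>2"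
    using assms(1) by (simp add: field_simps power2_eq_square)
  finally show ?thesis .
qed

text \<open>Saddle points are passed to the lemmas instead of being fixed here, because the
  convergence proof applies the same lemmas to the given saddle point and to a cluster
  point.\<close>

locale adaptive_golden_admm =
  fixes g :: "real^'q \<Rightarrow> ereal" and f :: "real^'p \<Rightarrow> ereal"
    and A :: "real^'q^'m" and B :: "real^'p^'m" and b :: "real^'m"
    and S :: "real^'q^'q" and T :: "real^'p^'p"
    and \<beta> \<psi> \<rho> r1 r :: real and \<xi> :: "nat \<Rightarrow> real"
    and u x :: "nat \<Rightarrow> real^'q" and w :: "nat \<Rightarrow> real^'p" and y :: "nat \<Rightarrow> real^'m"
    and \<tau> \<sigma> :: "nat \<Rightarrow> real"
  assumes g: "proper_closed_convex g" and f: "proper_closed_convex f"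
    and alg: "algorithm g f A B b S T \<beta> \<psi> \<rho> r1 r \<xi> u x w y \<tau> \<sigma>"
begin

abbreviation "gr z \<equiv> real_of_ereal (g z)"
abbreviation "fr z \<equiv> real_of_ereal (f z)"
abbreviation "res \<equiv> residual A B b"

definition scale :: real where
  "scale = sqrt (lambda_min S) / sqrt \<beta>"

lemma params:
  shows S: "sym_pos_def S" and T: "sym_pos_def T" and \<tau>0: "0 < \<tau> 0" and \<beta>: "0 < \<beta>"
    and \<psi>: "1 < \<psi>" "\<psi> < golden_ratio" and \<rho>: "1 \<le> \<rho>" "\<rho> < 2"
    and r: "0 < r1" "r1 < r" "r < \<rho> / 2"
    and \<xi>: "1 < \<rho> + \<xi> k" "summable (\<lambda>k. ln (\<rho> + \<xi> (Suc k)))"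
proof -
  have P: "alg_params S T (\<tau> 0) \<beta> \<psi> \<rho> r1 r \<xi>"
    using alg by (simp add: algorithm_def)
  then show "sym_pos_def S" "sym_pos_def T" "0 < \<tau> 0" "0 < \<beta>" "\<psi> < golden_ratio" "1 \<le> \<rho>"
    "0 < r1" "r1 < r" "r < \<rho> / 2" "1 < \<rho> + \<xi> k" "summable (\<lambda>k. ln (\<rho> + \<xi> (Suc k)))"
    by (auto simp: alg_params_def)
  show \<psi>: "1 < \<psi>"
    using P by (simp add: alg_params_def)
  \<comment> \<open>Both summands of the upper bound for \<open>\<rho>\<close> lie below 1. The
    result \<open>\<rho> < 2\<close> keeps the coefficient \<open>1 - \<rho> / 2\<close> in
    \<open>decrement\<close> positive.\<close>
  have "1 / \<psi> < 1" "1 / \<psi>\<^sup>2 < 1"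
    using \<psi> by (simp_all add: one_less_power)
  then show "\<rho> < 2"
    using P unfolding alg_params_def by linarith
qed

lemma scale_pos: "0 < scale"
  using lambda_min_rayleigh(1)[OF S] \<beta> by (simp add: scale_def)

section \<open>Recursions, step sizes and optimality conditions of the subproblems\<close>

lemma
  shows u_Suc: "u (Suc n) = ((\<psi> - 1) / \<psi>) *\<^sub>R x n + (1 / \<psi>) *\<^sub>R u n"
    and x_arg_min: "is_arg_min (x_objective g A B b S (\<tau> n) (u (Suc n)) (w n) (y n))
      (\<lambda>_. True) (x (Suc n))"
    and \<sigma>_Suc: "\<sigma> (Suc n) = \<beta> * \<tau> (Suc n)"
    and w_arg_min: "is_arg_min (w_objective g f A B b T (\<sigma> (Suc n)) (x (Suc n)) (w n) (y n))
      (\<lambda>_. True) (w (Suc n))"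
    and y_Suc: "y (Suc n) = y n + \<sigma> (Suc n) *\<^sub>R res (x (Suc n)) (w (Suc n))"
    and \<tau>_Suc': "\<tau> (Suc n) = (if x (Suc n) \<noteq> x n \<and>
                  \<tau> n * L_ratio A x (Suc n) > r * sqrt (lambda_min S) / sqrt \<beta>
                then r1 * sqrt (lambda_min S) / (sqrt \<beta> * L_ratio A x (Suc n))
                else (\<rho> + \<xi> n) * \<tau> n)"
  using conjunct2[OF conjunct2[OF alg[unfolded algorithm_def]], rule_format, of "Suc n"]
  by auto

text \<open>For equal iterates \<open>L_ratio\<close> is 0, as a quotient by zero, and lies below
  the positive threshold. The rule thus needs no separate case.\<close>

lemma \<tau>_Suc: "\<tau> (Suc n) = (if \<tau> n * L_ratio A x (Suc n) > r * scale
    then r1 * scale / L_ratio A x (Suc n) else (\<rho> + \<xi> n) * \<tau> n)"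
proof (cases "x (Suc n) = x n")
  case True
  have "0 < r * scale"
    using r scale_pos by simp
  then show ?thesis
    unfolding \<tau>_Suc'[of n] using True by (simp add: L_ratio_def)
qed (simp add: \<tau>_Suc' scale_def)

lemma L_ratio_le: "L_ratio A x k \<le> onorm ((*v) A)"
  using onorm[OF matrix_vector_mul_bounded_linear, of A "x k - x (k - 1)"]
  by (simp add: L_ratio_def matrix_vector_mult_diff_distrib divide_le_eq onorm_pos_le mult.commute)

lemmas stepsize = adaptive_stepsize[OF r(1,2) scale_pos \<tau>0 L_ratio_le \<xi> \<tau>_Suc]

lemma \<tau>_lower_bound: obtains \<delta> where "0 < \<delta>" "\<And>k. \<delta> \<le> \<tau> k"
  using stepsize(1) by blast

lemma \<tau>_pos: "0 < \<tau> k"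
  using \<tau>_lower_bound by (metis less_le_trans)

lemma
  shows x_dom: "x (Suc n) \<in> edom g"
    and x_ineq: "g (x (Suc n)) \<le> g z + ereal (y n \<bullet> (A *v (z - x (Suc n)))
      + (1 / \<tau> n) * ((z - x (Suc n)) \<bullet> (S *v (x (Suc n) - u (Suc n)))))"
proof -
  let ?x = "x (Suc n)" and ?u = "u (Suc n)"
  let ?q = "\<lambda>z. y n \<bullet> res z (w n) + 1 / (2 * \<tau> n) * (mnorm S (z - ?u))\<^sup>2"
  have min: "is_arg_min (\<lambda>z. g z + ereal (?q z)) (\<lambda>_. True) ?x"
    using x_arg_min[of n] unfolding x_objective_def add.assoc plus_ereal.simps .
  have expand: "?q (?x + t *\<^sub>R d) = ?q ?x
      + t * (y n \<bullet> (A *v d) + (1 / \<tau> n) * (d \<bullet> (S *v (?x - ?u))))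
      + t\<^sup>2 * (1 / (2 * \<tau> n) * (mnorm S d)\<^sup>2)" for t d
  proof -
    have "?x + t *\<^sub>R d - ?u = (?x - ?u) + t *\<^sub>R d"
      by simp
    then show ?thesis
      using \<tau>_pos[of n] by (simp only: mnorm_sq_line[OF S] residual_line_x)
        (simp add: inner_add_right field_simps)
  qed
  show "?x \<in> edom g"
    by (rule arg_min_variational_ineq(1)[OF g min expand])
  show "g (x (Suc n)) \<le> g z + ereal (y n \<bullet> (A *v (z - x (Suc n)))
      + (1 / \<tau> n) * ((z - x (Suc n)) \<bullet> (S *v (x (Suc n) - u (Suc n)))))"
    by (rule arg_min_variational_ineq(2)[OF g min expand])
qed

text \<open>The derivative of the multiplier and penalty terms at the minimizer pairs
  \<open>B *v d\<close> with \<open>y n\<close> plus \<open>\<sigma> (Suc n)\<close> times the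
  residual, which is \<open>y (Suc n)\<close>: the dual update absorbs the penalty.\<close>

lemma
  shows w_dom: "w (Suc n) \<in> edom f"
    and w_ineq: "f (w (Suc n)) \<le> f z + ereal (y (Suc n) \<bullet> (B *v (z - w (Suc n)))
      + (1 / (\<beta> * \<tau> (Suc n))) * ((z - w (Suc n)) \<bullet> (T *v (w (Suc n) - w n))))"
proof -
  let ?x = "x (Suc n)" and ?w = "w (Suc n)" and ?s = "\<sigma> (Suc n)"
  let ?q = "\<lambda>z. gr ?x + y n \<bullet> res ?x z + ?s / 2 * (norm (res ?x z))\<^sup>2
    + 1 / (2 * ?s) * (mnorm T (z - w n))\<^sup>2"
  have s: "0 < ?s"
    using \<beta> \<tau>_pos by (simp add: \<sigma>_Suc)
  \<comment> \<open>\<open>g ?x\<close> is finite by \<open>x_dom\<close> and can therefore join the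
    real-valued part \<open>?q\<close>.\<close>
  have "w_objective g f A B b T ?s ?x (w n) (y n) = (\<lambda>z. f z + ereal (?q z))"
    unfolding w_objective_def aug_Lagr_def Lagr_def Phi_def
    by (subst pcc_ereal[OF g x_dom]) (simp add: ac_simps flip: plus_ereal.simps(1))
  then have min: "is_arg_min (\<lambda>z. f z + ereal (?q z)) (\<lambda>_. True) ?w"
    using w_arg_min[of n] by simp
  have expand: "?q (?w + t *\<^sub>R d) = ?q ?w
      + t * (y (Suc n) \<bullet> (B *v d) + (1 / (\<beta> * \<tau> (Suc n))) * (d \<bullet> (T *v (?w - w n))))
      + t\<^sup>2 * (?s / 2 * (norm (B *v d))\<^sup>2 + 1 / (2 * ?s) * (mnorm T d)\<^sup>2)" for t d
  proof -
    have "?w + t *\<^sub>R d - w n = (?w - w n) + t *\<^sub>R d"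
      by simp
    then have "?q (?w + t *\<^sub>R d) = gr ?x + y n \<bullet> (res ?x ?w + t *\<^sub>R (B *v d))
        + ?s / 2 * (norm (res ?x ?w + t *\<^sub>R (B *v d)))\<^sup>2
        + 1 / (2 * ?s) * ((mnorm T (?w - w n))\<^sup>2 + t * (2 * (d \<bullet> (T *v (?w - w n))))
          + t\<^sup>2 * (mnorm T d)\<^sup>2)"
      by (simp only: mnorm_sq_line[OF T] residual_line_w)
    also have "(norm (res ?x ?w + t *\<^sub>R (B *v d)))\<^sup>2 =
        (norm (res ?x ?w))\<^sup>2 + 2 * t * (res ?x ?w \<bullet> (B *v d)) + t\<^sup>2 * (norm (B *v d))\<^sup>2"
      unfolding power2_norm_eq_inner
      by (simp add: inner_add_left inner_add_right inner_commute power2_eq_square algebra_simps)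
    finally show ?thesis
      unfolding y_Suc \<sigma>_Suc[symmetric] using s
      by (simp add: inner_add_left inner_add_right field_simps)
  qed
  show "?w \<in> edom f"
    by (rule arg_min_variational_ineq(1)[OF f min expand])
  show "f (w (Suc n)) \<le> f z + ereal (y (Suc n) \<bullet> (B *v (z - w (Suc n)))
      + (1 / (\<beta> * \<tau> (Suc n))) * ((z - w (Suc n)) \<bullet> (T *v (w (Suc n) - w n))))"
    by (rule arg_min_variational_ineq(2)[OF f min expand])
qed

lemma x_ineq_real:
  assumes "z \<in> edom g"
  shows "gr (x (Suc n)) \<le> gr z + (y n \<bullet> (A *v (z - x (Suc n)))
      + (1 / \<tau> n) * ((z - x (Suc n)) \<bullet> (S *v (x (Suc n) - u (Suc n)))))"
proof -
  have "ereal (gr (x (Suc n))) \<le> ereal (gr z) + ereal (y n \<bullet> (A *v (z - x (Suc n)))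
      + (1 / \<tau> n) * ((z - x (Suc n)) \<bullet> (S *v (x (Suc n) - u (Suc n)))))"
    unfolding pcc_ereal[OF g assms, symmetric] pcc_ereal[OF g x_dom, symmetric] by (rule x_ineq)
  then show ?thesis
    by simp
qed

lemma w_ineq_real:
  assumes "z \<in> edom f"
  shows "fr (w (Suc n)) \<le> fr z + (y (Suc n) \<bullet> (B *v (z - w (Suc n)))
      + (1 / (\<beta> * \<tau> (Suc n))) * ((z - w (Suc n)) \<bullet> (T *v (w (Suc n) - w n))))"
proof -
  have "ereal (fr (w (Suc n))) \<le> ereal (fr z) + ereal (y (Suc n) \<bullet> (B *v (z - w (Suc n)))
      + (1 / (\<beta> * \<tau> (Suc n))) * ((z - w (Suc n)) \<bullet> (T *v (w (Suc n) - w n))))"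
    unfolding pcc_ereal[OF f assms, symmetric] pcc_ereal[OF f w_dom, symmetric] by (rule w_ineq)
  then show ?thesis
    by simp
qed

section \<open>Energy, decrement and regular steps\<close>

text \<open>Index \<open>n\<close> belongs to iteration \<open>Suc n\<close> of the algorithm.\<close>

definition energy :: "real^'q \<Rightarrow> real^'p \<Rightarrow> real^'m \<Rightarrow> nat \<Rightarrow> real" where
  "energy xb wb v n = \<psi> / (\<psi> - 1) * (mnorm S (u (n + 2) - xb))\<^sup>2
     + 1 / \<beta> * (mnorm T (wb - w n))\<^sup>2 + 1 / \<beta> * (norm (v - y n))\<^sup>2"

text \<open>The last three terms of the estimate for \<open>k = Suc n\<close>. The coefficient
  \<open>1 - \<rho> / 2\<close> is what the coupling term leaves of the dual one.\<close>

definition decrement :: "nat \<Rightarrow> real" where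
  "decrement n = 1 / \<beta> * (mnorm T (w (Suc n) - w n))\<^sup>2
     + 1 / \<beta> * (1 - \<rho> / 2) * (norm (y (Suc n) - y n))\<^sup>2
     + \<psi> * \<tau> (Suc n) / \<tau> n * (mnorm S (x (Suc n) - u (n + 2)))\<^sup>2"

text \<open>The multiplier \<open>v\<close> stays free: the multiplier of a saddle point makes the
  gap nonnegative, while the ergodic rate takes a \<open>v\<close> that depends on the number of
  averaged terms.\<close>

definition gap :: "real^'q \<Rightarrow> real^'p \<Rightarrow> real^'m \<Rightarrow> nat \<Rightarrow> real" where
  "gap xb wb v k = gr (x k) + fr (w k) + v \<bullet> res (x k) (w k) - (gr xb + fr wb)"

text \<open>In this order the conditions bound the coupling with \<open>x (n + 2)\<close>, give
  \<open>1 \<le> \<theta>\<close> in \<open>one_step\<close>, and make the coefficient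
  \<open>1 + 1 / \<psi> - \<theta>\<close> there nonnegative.\<close>

definition regular_step :: "nat \<Rightarrow> bool" where
  "regular_step n \<longleftrightarrow> \<tau> (Suc n) * L_ratio A x (Suc (Suc n)) \<le> r * scale \<and>
     \<tau> n \<le> \<tau> (Suc n) \<and> \<psi> * \<tau> (Suc n) / \<tau> n \<le> 1 + 1 / \<psi>"

text \<open>Once reductions have stopped, consecutive step sizes have the ratio
  \<open>\<rho> + \<xi> n\<close>, which exceeds 1 and tends to 1, hence falls below
  \<open>1 / \<psi> + 1 / \<psi>\<^sup>2\<close>.\<close>

lemma eventually_regular: "\<forall>\<^sub>F n in sequentially. regular_step n"
proof -
  have "\<forall>\<^sub>F n in sequentially. \<tau> (Suc n) * L_ratio A x (Suc (Suc n)) \<le> r * scale"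
    using stepsize(2) by (rule eventually_sequentially_Suc[THEN iffD2])
  moreover have "\<forall>\<^sub>F n in sequentially. \<rho> + \<xi> n < 1 / \<psi> + 1 / \<psi>\<^sup>2"
    using stepsize(3) golden_ratio_bound[of \<psi>] \<psi> by (intro order_tendstoD(2)) auto
  ultimately show ?thesis
    using stepsize(2)
  proof eventually_elim
    case (elim n)
    have eq: "\<tau> (Suc n) = (\<rho> + \<xi> n) * \<tau> n"
      using elim(3) by (simp add: \<tau>_Suc)
    have "\<tau> n \<le> \<tau> (Suc n)"
      using \<xi>(1)[of n] \<tau>_pos[of n] by (simp add: eq mult_le_cancel_right1)
    moreover have "\<psi> * \<tau> (Suc n) / \<tau> n = \<psi> * (\<rho> + \<xi> n)"
      using \<tau>_pos[of n] by (simp add: eq)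
    moreover have "\<psi> * (\<rho> + \<xi> n) \<le> \<psi> * (1 / \<psi> + 1 / \<psi>\<^sup>2)"
      using elim(2) \<psi> by (intro mult_left_mono) auto
    moreover have "\<psi> * (1 / \<psi> + 1 / \<psi>\<^sup>2) = 1 + 1 / \<psi>"
      using \<psi> by (simp add: field_simps power2_eq_square)
    ultimately show ?case
      using elim(1) by (simp add: regular_step_def)
  qed
qed

text \<open>The step-size test takes the place of a global bound on \<open>A\<close>: it controls
  the ratio for exactly the two iterates involved. Cauchy-Schwarz and Young's inequality do the
  rest.\<close>

lemma coupling_bound:
  assumes "regular_step n"
  shows "2 * \<tau> (Suc n) * ((y n - y (Suc n)) \<bullet> (A *v (x (n + 2) - x (Suc n))))
    \<le> \<rho> / 2 * (1 / \<beta> * (norm (y (Suc n) - y n))\<^sup>2) + (mnorm S (x (n + 2) - x (Suc n)))\<^sup>2"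
proof -
  let ?dx = "x (n + 2) - x (Suc n)" and ?dy = "y (Suc n) - y n"
  let ?L = "L_ratio A x (n + 2)"
  \<comment> \<open>Scaled so that \<open>scale\<close> times the product of the two norms is
    \<open>p * q\<close>, \<open>p\<^sup>2\<close> is the dual term, and \<open>q\<^sup>2\<close> is
    at most \<open>(mnorm S ?dx)\<^sup>2\<close>.\<close>
  define p q where "p = norm ?dy / sqrt \<beta>" and "q = sqrt (lambda_min S) * norm ?dx"
  have lam: "0 < lambda_min S"
    by (rule lambda_min_rayleigh(1)[OF S])
  have norm_A: "norm (A *v ?dx) = ?L * norm ?dx"
    by (simp add: L_ratio_def matrix_vector_mult_diff_distrib)
  have "(y n - y (Suc n)) \<bullet> (A *v ?dx) \<le> norm ?dy * norm (A *v ?dx)"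
    using norm_cauchy_schwarz by (metis norm_minus_commute)
  then have "2 * \<tau> (Suc n) * ((y n - y (Suc n)) \<bullet> (A *v ?dx))
      \<le> 2 * \<tau> (Suc n) * (norm ?dy * (?L * norm ?dx))"
    unfolding norm_A[symmetric] using \<tau>_pos[of "Suc n"] by simp
  also have "\<dots> = 2 * (\<tau> (Suc n) * ?L) * (norm ?dy * norm ?dx)"
    by simp
  also have "\<dots> \<le> 2 * (r * scale) * (norm ?dy * norm ?dx)"
    using assms by (intro mult_right_mono) (auto simp: regular_step_def)
  also have "\<dots> = 2 * r * (p * q)"
    by (simp add: p_def q_def scale_def)
  also have "\<dots> \<le> 2 * (\<rho> / 2) * (p * q)"
    using r \<beta> lam by (intro mult_right_mono) (auto simp: p_def q_def)
  also have "\<dots> \<le> \<rho> / 2 * (p\<^sup>2 + q\<^sup>2)"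
    using mult_left_mono[OF sum_squares_bound[of p q], of "\<rho> / 2"] \<rho> by simp
  \<comment> \<open>Only the primal square is raised to full weight, since \<open>one_step\<close>
    can absorb that much of it; the dual square has to keep a factor below 1.\<close>
  also have "\<dots> \<le> \<rho> / 2 * p\<^sup>2 + q\<^sup>2"
    using mult_right_mono[of "\<rho> / 2" 1 "q\<^sup>2"] \<rho> by (simp add: distrib_left)
  also have "q\<^sup>2 \<le> (mnorm S ?dx)\<^sup>2"
    using mnorm_sq_ge[OF S, of ?dx] lam by (simp add: q_def power_mult_distrib)
  finally show ?thesis
    using \<beta> by (simp add: p_def power_divide)
qed

lemma one_step:
  assumes xb: "xb \<in> edom g" and wb: "wb \<in> edom f" and feas: "res xb wb = 0"
    and reg: "regular_step n"
  shows "2 * \<tau> (Suc n) * gap xb wb v (Suc n)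
    \<le> energy xb wb v n - energy xb wb v (Suc n) - decrement n"
proof -
  define x0 x1 u1 u2 where "x0 = x (Suc n)" and "x1 = x (n + 2)" and "u1 = u (n + 2)"
    and "u2 = u (n + 3)"
  define w0 w1 y0 y1 where "w0 = w n" and "w1 = w (Suc n)" and "y0 = y n" and "y1 = y (Suc n)"
  define t0 t1 where "t0 = \<tau> n" and "t1 = \<tau> (Suc n)"
  define \<theta> where "\<theta> = \<psi> * t1 / t0"
  have t: "0 < t0" "0 < t1"
    using \<tau>_pos by (simp_all add: t0_def t1_def)
  \<comment> \<open>Moves the anchor of the earlier proximal step from \<open>u (n + 1)\<close> to
    \<open>u (n + 2)\<close>, the anchor of the new step, at the price of a factor
    \<open>\<psi>\<close>.\<close>
  have u1_eq: "x0 - u (Suc n) = \<psi> *\<^sub>R (x0 - u1)"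
    using \<psi> unfolding u1_def x0_def
    by (simp add: u_Suc[of "Suc n"] numeral_2_eq_2 algebra_simps diff_divide_distrib)
  have u2_eq: "u2 = ((\<psi> - 1) / \<psi>) *\<^sub>R x1 + (1 / \<psi>) *\<^sub>R u1"
    using u_Suc[of "n + 2"] by (simp add: u2_def x1_def u1_def numeral_3_eq_3 numeral_2_eq_2)
  have A1: "gr x1 \<le> gr xb + (y1 \<bullet> (A *v (xb - x1)) + (1 / t1) * ((xb - x1) \<bullet> (S *v (x1 - u1))))"
    using x_ineq_real[OF xb, of "Suc n"] by (simp add: x1_def u1_def y1_def t1_def)
  \<comment> \<open>The previous iterate is compared with the new one, not with \<open>xb\<close>.\<close>
  have "x1 \<in> edom g"
    using x_dom[of "Suc n"] by (simp add: x1_def)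
  from x_ineq_real[OF this, of n]
  have A2: "gr x0 \<le> gr x1 + (y0 \<bullet> (A *v (x1 - x0)) + (\<psi> / t0) * ((x1 - x0) \<bullet> (S *v (x0 - u1))))"
    using u1_eq by (simp add: x0_def y0_def t0_def matrix_vector_mult_scaleR)
  have A3: "fr w1 \<le> fr wb + (y1 \<bullet> (B *v (wb - w1)) + (1 / (\<beta> * t1)) * ((wb - w1) \<bullet> (T *v (w1 - w0))))"
    using w_ineq_real[OF wb, of n] by (simp add: w1_def w0_def y1_def t1_def)
  \<comment> \<open>With the residual as a difference of multipliers,
    \<open>(v - y1) \<bullet> res x0 w1\<close> expands into squared distances that
    telescope.\<close>
  have y1_eq: "y1 - y0 = (\<beta> * t1) *\<^sub>R res x0 w1"
    by (simp add: y1_def y0_def y_Suc \<sigma>_Suc t1_def x0_def w1_def)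
  have res_eq: "res x0 w1 = - (A *v (xb - x0)) - B *v (wb - w1)"
    using residual_diff[of A B b xb wb x0 w1] feas by (simp add: algebra_simps)
  have "gr x0 + fr w1 - (gr xb + fr wb)
      \<le> y1 \<bullet> (A *v (xb - x1)) + y0 \<bullet> (A *v (x1 - x0)) + y1 \<bullet> (B *v (wb - w1))
        + (1 / t1) * ((xb - x1) \<bullet> (S *v (x1 - u1))) + (\<psi> / t0) * ((x1 - x0) \<bullet> (S *v (x0 - u1)))
        + (1 / (\<beta> * t1)) * ((wb - w1) \<bullet> (T *v (w1 - w0)))"
    using A1 A2 A3 by simp
  \<comment> \<open>The two inequalities for \<open>x\<close> carry the different multipliers
    \<open>y1\<close> and \<open>y0\<close>; their mismatch is the coupling term.\<close>
  also have "y1 \<bullet> (A *v (xb - x1)) + y0 \<bullet> (A *v (x1 - x0)) + y1 \<bullet> (B *v (wb - w1))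
      = - (y1 \<bullet> res x0 w1) + (y0 - y1) \<bullet> (A *v (x1 - x0))"
    by (simp add: res_eq inner_diff_left inner_diff_right inner_add_right
        matrix_vector_mult_diff_distrib)
  finally have "gr x0 + fr w1 + v \<bullet> res x0 w1 - (gr xb + fr wb)
      \<le> (v - y1) \<bullet> res x0 w1 + (y0 - y1) \<bullet> (A *v (x1 - x0))
        + (1 / t1) * ((xb - x1) \<bullet> (S *v (x1 - u1))) + (\<psi> / t0) * ((x1 - x0) \<bullet> (S *v (x0 - u1)))
        + (1 / (\<beta> * t1)) * ((wb - w1) \<bullet> (T *v (w1 - w0)))"
    by (simp add: inner_diff_left)
  then have "2 * t1 * (gr x0 + fr w1 + v \<bullet> res x0 w1 - (gr xb + fr wb))
      \<le> 2 * t1 * ((v - y1) \<bullet> res x0 w1 + (y0 - y1) \<bullet> (A *v (x1 - x0))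
        + (1 / t1) * ((xb - x1) \<bullet> (S *v (x1 - u1))) + (\<psi> / t0) * ((x1 - x0) \<bullet> (S *v (x0 - u1)))
        + (1 / (\<beta> * t1)) * ((wb - w1) \<bullet> (T *v (w1 - w0))))"
    using t by (intro mult_left_mono) auto
  also have "\<dots> = 1 / \<beta> * (2 * ((v - y1) \<bullet> (y1 - y0))) + 2 * t1 * ((y0 - y1) \<bullet> (A *v (x1 - x0)))
      + (2 * ((xb - x1) \<bullet> (S *v (x1 - u1))) + 2 * \<theta> * ((x1 - x0) \<bullet> (S *v (x0 - u1))))
      + 1 / \<beta> * (2 * ((wb - w1) \<bullet> (T *v (w1 - w0))))"
    using t \<beta> unfolding y1_eq \<theta>_def by (simp add: field_simps)
  also have "2 * ((v - y1) \<bullet> (y1 - y0)) = (norm (v - y0))\<^sup>2 - (norm (v - y1))\<^sup>2 - (norm (y1 - y0))\<^sup>2"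
    unfolding power2_norm_eq_inner
    by (simp add: inner_diff_left inner_diff_right inner_commute)
  also have "2 * ((wb - w1) \<bullet> (T *v (w1 - w0)))
      = (mnorm T (wb - w0))\<^sup>2 - (mnorm T (wb - w1))\<^sup>2 - (mnorm T (w1 - w0))\<^sup>2"
    by (rule three_point_identity[OF T])
  also note golden_step_identity[OF S \<psi>(1) u2_eq]
  finally have main: "2 * t1 * (gr x0 + fr w1 + v \<bullet> res x0 w1 - (gr xb + fr wb))
      \<le> 1 / \<beta> * ((norm (v - y0))\<^sup>2 - (norm (v - y1))\<^sup>2 - (norm (y1 - y0))\<^sup>2)
        + 2 * t1 * ((y0 - y1) \<bullet> (A *v (x1 - x0)))
        + (\<psi> / (\<psi> - 1) * ((mnorm S (u1 - xb))\<^sup>2 - (mnorm S (u2 - xb))\<^sup>2)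
          - (1 + 1 / \<psi> - \<theta>) * (mnorm S (x1 - u1))\<^sup>2
          - \<theta> * (mnorm S (x0 - u1))\<^sup>2 - \<theta> * (mnorm S (x1 - x0))\<^sup>2)
        + 1 / \<beta> * ((mnorm T (wb - w0))\<^sup>2 - (mnorm T (wb - w1))\<^sup>2 - (mnorm T (w1 - w0))\<^sup>2)" .
  have cross: "2 * t1 * ((y0 - y1) \<bullet> (A *v (x1 - x0)))
      \<le> \<rho> / 2 * (1 / \<beta> * (norm (y1 - y0))\<^sup>2) + (mnorm S (x1 - x0))\<^sup>2"
    using coupling_bound[OF reg] by (simp add: x0_def x1_def y0_def y1_def t1_def)
  \<comment> \<open>\<open>1 \<le> \<theta>\<close> lets the negative term in
    \<open>mnorm S (x1 - x0)\<close> absorb the primal square in \<open>cross\<close>.\<close>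
  have "1 * 1 \<le> \<psi> * (t1 / t0)"
    using reg t \<psi> by (intro mult_mono) (auto simp: regular_step_def t0_def t1_def)
  then have "1 \<le> \<theta>"
    by (simp add: \<theta>_def)
  then have "(mnorm S (x1 - x0))\<^sup>2 \<le> \<theta> * (mnorm S (x1 - x0))\<^sup>2"
    by (simp add: mult_le_cancel_right1)
  moreover have "0 \<le> (1 + 1 / \<psi> - \<theta>) * (mnorm S (x1 - u1))\<^sup>2"
    using reg by (intro mult_nonneg_nonneg) (auto simp: regular_step_def \<theta>_def t0_def t1_def)
  moreover have "2 * \<tau> (Suc n) * gap xb wb v (Suc n)
      = 2 * t1 * (gr x0 + fr w1 + v \<bullet> res x0 w1 - (gr xb + fr wb))"
    by (simp add: gap_def x0_def w1_def t1_def)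
  moreover have "energy xb wb v n = \<psi> / (\<psi> - 1) * (mnorm S (u1 - xb))\<^sup>2
     + 1 / \<beta> * (mnorm T (wb - w0))\<^sup>2 + 1 / \<beta> * (norm (v - y0))\<^sup>2"
    by (simp add: energy_def u1_def w0_def y0_def)
  moreover have "energy xb wb v (Suc n) = \<psi> / (\<psi> - 1) * (mnorm S (u2 - xb))\<^sup>2
     + 1 / \<beta> * (mnorm T (wb - w1))\<^sup>2 + 1 / \<beta> * (norm (v - y1))\<^sup>2"
    by (simp add: energy_def u2_def w1_def y1_def numeral_3_eq_3)
  moreover have "decrement n = 1 / \<beta> * (mnorm T (w1 - w0))\<^sup>2
     + 1 / \<beta> * (norm (y1 - y0))\<^sup>2 - \<rho> / 2 * (1 / \<beta> * (norm (y1 - y0))\<^sup>2)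
     + \<theta> * (mnorm S (x0 - u1))\<^sup>2"
    by (simp add: decrement_def w0_def w1_def y0_def y1_def x0_def u1_def \<theta>_def t0_def t1_def
        algebra_simps)
  ultimately show ?thesis
    using main cross by (simp only: right_diff_distrib)
qed

section \<open>Convergence of the iterates\<close>

lemma regular_from: obtains K where "\<And>n. K \<le> n \<Longrightarrow> regular_step n"
  using eventually_regular by (auto simp: eventually_sequentially)

lemma decrement_nonneg: "0 \<le> decrement n"
  using \<beta> \<psi> \<rho> \<tau>_pos[of n] \<tau>_pos[of "Suc n"] by (simp add: decrement_def)

lemma energy_nonneg: "0 \<le> energy xb wb v n"
  using \<beta> \<psi> by (simp add: energy_def)

lemma saddle_gap_nonneg:
  assumes "saddle_point g f A B b xb wb yb"
  shows "0 \<le> gap xb wb yb (Suc n)"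
  using saddle_point_imp(5)[OF g f assms x_dom w_dom, of n n] by (simp add: gap_def)

text \<open>The left-hand side of \<open>one_step\<close> is nonnegative for the multiplier of a
  saddle point, so the energy is a Lyapunov function along regular steps.\<close>

lemma energy_Suc_le:
  assumes "saddle_point g f A B b xb wb yb" and "regular_step n"
  shows "energy xb wb yb (Suc n) + decrement n \<le> energy xb wb yb n"
proof -
  have "0 \<le> 2 * \<tau> (Suc n) * gap xb wb yb (Suc n)"
    using saddle_gap_nonneg[OF assms(1)] \<tau>_pos[of "Suc n"] by simp
  then show ?thesis
    using one_step[OF saddle_point_imp(1-3)[OF g f assms(1)] assms(2), of yb] by linarith
qed

lemma energy_convergent:
  assumes "saddle_point g f A B b xb wb yb"
  shows "\<exists>l. energy xb wb yb \<longlonglongrightarrow> l"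
proof -
  obtain K where K: "\<And>n. K \<le> n \<Longrightarrow> regular_step n"
    using regular_from by blast
  have "decseq (\<lambda>n. energy xb wb yb (n + K))"
    unfolding decseq_Suc_iff
  proof
    fix n
    show "energy xb wb yb (Suc n + K) \<le> energy xb wb yb (n + K)"
      using energy_Suc_le[OF assms K, of "n + K"] decrement_nonneg[of "n + K"] by simp
  qed
  then show ?thesis
  proof (rule decseq_convergent)
    show "\<forall>n. 0 \<le> energy xb wb yb (n + K)"
      by (simp add: energy_nonneg)
    show ?thesis if "(\<lambda>n. energy xb wb yb (n + K)) \<longlonglongrightarrow> l" for l
      using LIMSEQ_offset[OF that] by blast
  qed
qed

text \<open>The decrement is eventually at most the difference of consecutive values of a convergent
  sequence, so each of its nonnegative terms tends to 0.\<close>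

lemma step_limits:
  assumes saddle: "saddle_point g f A B b xb wb yb"
  shows "(\<lambda>n. w (Suc n) - w n) \<longlonglongrightarrow> 0" "(\<lambda>n. y (Suc n) - y n) \<longlonglongrightarrow> 0"
    "(\<lambda>n. x (Suc n) - u (n + 2)) \<longlonglongrightarrow> 0"
proof -
  let ?E = "energy xb wb yb"
  obtain l where l: "?E \<longlonglongrightarrow> l"
    using energy_convergent[OF saddle] by blast
  then have lim: "(\<lambda>n. ?E n - ?E (Suc n)) \<longlonglongrightarrow> 0"
    using tendsto_diff[OF l LIMSEQ_Suc[OF l]] by simp
  have le: "\<forall>\<^sub>F n in sequentially. decrement n \<le> ?E n - ?E (Suc n)"
    using eventually_regular by eventually_elim (use energy_Suc_le[OF saddle] in force)
  have null: "s \<longlonglongrightarrow> 0" if s: "\<And>n. 0 \<le> s n" and c: "0 < c"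
    and sle: "\<forall>\<^sub>F n in sequentially. c * s n \<le> decrement n" for s :: "nat \<Rightarrow> real" and c
  proof (rule real_tendsto_sandwich)
    show "(\<lambda>n. 0 :: real) \<longlonglongrightarrow> 0"
      by simp
    show "\<forall>\<^sub>F n in sequentially. s n \<le> (?E n - ?E (Suc n)) / c"
      using sle le by eventually_elim (use c in \<open>simp add: pos_le_divide_eq mult.commute\<close>)
    show "(\<lambda>n. (?E n - ?E (Suc n)) / c) \<longlonglongrightarrow> 0"
      using tendsto_divide[OF lim tendsto_const, of c] c by simp
  qed (use s in auto)
  have parts: "0 \<le> 1 / \<beta> * (mnorm T (w (Suc n) - w n))\<^sup>2"
    "0 \<le> 1 / \<beta> * (1 - \<rho> / 2) * (norm (y (Suc n) - y n))\<^sup>2"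
    "0 \<le> \<psi> * \<tau> (Suc n) / \<tau> n * (mnorm S (x (Suc n) - u (n + 2)))\<^sup>2" for n
    using \<beta> \<psi> \<rho> \<tau>_pos[of n] \<tau>_pos[of "Suc n"] by simp_all
  show "(\<lambda>n. w (Suc n) - w n) \<longlonglongrightarrow> 0"
  proof (rule mnorm_sq_tendsto_0_imp[OF T], rule null)
    show "\<forall>\<^sub>F n in sequentially. 1 / \<beta> * (mnorm T (w (Suc n) - w n))\<^sup>2 \<le> decrement n"
      using parts(2,3) by (simp only: decrement_def) simp
  qed (use \<beta> in auto)
  have "(\<lambda>n. (norm (y (Suc n) - y n))\<^sup>2) \<longlonglongrightarrow> 0"
  proof (rule null)
    show "\<forall>\<^sub>F n in sequentially. 1 / \<beta> * (1 - \<rho> / 2) * (norm (y (Suc n) - y n))\<^sup>2 \<le> decrement n"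
      using parts(1,3) by (simp only: decrement_def) simp
  qed (use \<beta> \<rho> in auto)
  then show "(\<lambda>n. y (Suc n) - y n) \<longlonglongrightarrow> 0"
    by (simp add: tendsto_norm_zero_iff)
  show "(\<lambda>n. x (Suc n) - u (n + 2)) \<longlonglongrightarrow> 0"
  proof (rule mnorm_sq_tendsto_0_imp[OF S], rule null)
    \<comment> \<open>The coefficient varies with \<open>n\<close>; on regular steps it is at least
      \<open>\<psi>\<close>.\<close>
    show "\<forall>\<^sub>F n in sequentially. \<psi> * (mnorm S (x (Suc n) - u (n + 2)))\<^sup>2 \<le> decrement n"
      using eventually_regular
    proof eventually_elim
      case (elim n)
      then have "\<psi> \<le> \<psi> * \<tau> (Suc n) / \<tau> n"
        using \<tau>_pos[of n] \<psi> by (simp add: regular_step_def pos_le_divide_eq)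
      then have "\<psi> * (mnorm S (x (Suc n) - u (n + 2)))\<^sup>2
          \<le> \<psi> * \<tau> (Suc n) / \<tau> n * (mnorm S (x (Suc n) - u (n + 2)))\<^sup>2"
        by (rule mult_right_mono) simp
      then show ?case
        using parts(1,2)[of n] unfolding decrement_def by linarith
    qed
  qed (use \<psi> in auto)
qed

text \<open>Step sizes stay above a positive constant. The index map \<open>s\<close> covers
  subsequences and shifted indices.\<close>

lemma tendsto_divide_stepsize_0:
  fixes v :: "nat \<Rightarrow> 'a::real_normed_vector"
  assumes "v \<longlonglongrightarrow> 0"
  shows "(\<lambda>n. (1 / \<tau> (s n)) *\<^sub>R v n) \<longlonglongrightarrow> 0"
proof -
  obtain \<delta> where \<delta>: "0 < \<delta>" "\<And>k. \<delta> \<le> \<tau> k"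
    using \<tau>_lower_bound by blast
  show ?thesis
  proof (rule tendsto_norm_zero_cancel, rule real_tendsto_sandwich)
    show "(\<lambda>n. 0 :: real) \<longlonglongrightarrow> 0"
      by simp
    have "norm (v n) / \<tau> (s n) \<le> norm (v n) / \<delta>" for n
      using \<delta> \<tau>_pos[of "s n"] by (intro divide_left_mono) auto
    then show "\<forall>\<^sub>F n in sequentially. norm ((1 / \<tau> (s n)) *\<^sub>R v n) \<le> norm (v n) / \<delta>"
      using \<tau>_pos by (simp add: less_imp_le)
    show "(\<lambda>n. norm (v n) / \<delta>) \<longlonglongrightarrow> 0"
      using tendsto_divide[OF tendsto_norm[OF assms] tendsto_const, of \<delta>] \<delta> by simp
  qed auto
qed

text \<open>Successive differences vanish even after division by the step sizes, so the proximal
  inequalities become the optimality conditions of \<open>saddle_pointI\<close> in the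
  limit.\<close>

lemma cluster_point_saddle:
  assumes saddle: "saddle_point g f A B b xb wb yb" and s: "strict_mono s"
    and u_lim: "(\<lambda>j. u (s j + 2)) \<longlonglongrightarrow> xs" and w_lim: "(\<lambda>j. w (s j)) \<longlonglongrightarrow> ws"
    and y_lim: "(\<lambda>j. y (s j)) \<longlonglongrightarrow> ys"
  shows "saddle_point g f A B b xs ws ys"
proof -
  note lims = step_limits[OF saddle, THEN LIMSEQ_subseq_LIMSEQ, OF s, unfolded o_def]
  have x_lim: "(\<lambda>j. x (Suc (s j))) \<longlonglongrightarrow> xs"
    using tendsto_add[OF lims(3) u_lim] by simp
  have w1_lim: "(\<lambda>j. w (Suc (s j))) \<longlonglongrightarrow> ws"
    using tendsto_add[OF lims(1) w_lim] by simp
  have y1_lim: "(\<lambda>j. y (Suc (s j))) \<longlonglongrightarrow> ys"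
    using tendsto_add[OF lims(2) y_lim] by simp
  have prox_x: "(\<lambda>j. (1 / \<tau> (s j)) *\<^sub>R (x (Suc (s j)) - u (Suc (s j)))) \<longlonglongrightarrow> 0"
  proof (rule tendsto_divide_stepsize_0)
    have "x (Suc n) - u (Suc n) = \<psi> *\<^sub>R (x (Suc n) - u (n + 2))" for n
      using \<psi> by (simp add: u_Suc[of "Suc n"] numeral_2_eq_2 algebra_simps diff_divide_distrib)
    then show "(\<lambda>j. x (Suc (s j)) - u (Suc (s j))) \<longlonglongrightarrow> 0"
      using tendsto_scaleR[OF tendsto_const lims(3), of \<psi>] by simp
  qed
  have prox_w: "(\<lambda>j. (1 / \<tau> (Suc (s j))) *\<^sub>R (w (Suc (s j)) - w (s j))) \<longlonglongrightarrow> 0"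
    by (rule tendsto_divide_stepsize_0) (rule lims(1))
  have "g xs \<le> g z + ereal (ys \<bullet> (A *v (z - xs)))" for z
  proof (cases "z \<in> edom g")
    case True
    have "g xs \<le> ereal (gr z + (ys \<bullet> (A *v (z - xs)) + (z - xs) \<bullet> (S *v 0)))"
    proof (rule pcc_lower_semicontinuous[OF g x_lim])
      show "(\<lambda>j. gr z + (y (s j) \<bullet> (A *v (z - x (Suc (s j)))) + (z - x (Suc (s j))) \<bullet>
          (S *v ((1 / \<tau> (s j)) *\<^sub>R (x (Suc (s j)) - u (Suc (s j)))))))
        \<longlonglongrightarrow> gr z + (ys \<bullet> (A *v (z - xs)) + (z - xs) \<bullet> (S *v 0))"
        by (intro tendsto_intros tendsto_matrix_vector_mult x_lim y_lim prox_x)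
      show "g (x (Suc (s j))) \<le> ereal (gr z + (y (s j) \<bullet> (A *v (z - x (Suc (s j))))
          + (z - x (Suc (s j))) \<bullet> (S *v ((1 / \<tau> (s j)) *\<^sub>R (x (Suc (s j)) - u (Suc (s j)))))))" for j
        using x_ineq_real[OF True, of "s j"]
        by (subst pcc_ereal[OF g x_dom]) (simp add: matrix_vector_mult_scaleR)
    qed
    moreover obtain c where "g z = ereal c"
      using pcc_ereal[OF g True] by blast
    ultimately show ?thesis
      by simp
  qed (simp add: edom_def)
  moreover have "f ws \<le> f z + ereal (ys \<bullet> (B *v (z - ws)))" for z
  proof (cases "z \<in> edom f")
    case True
    have "f ws \<le> ereal (fr z + (ys \<bullet> (B *v (z - ws)) + 1 / \<beta> * ((z - ws) \<bullet> (T *v 0))))"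
    proof (rule pcc_lower_semicontinuous[OF f w1_lim])
      show "(\<lambda>j. fr z + (y (Suc (s j)) \<bullet> (B *v (z - w (Suc (s j)))) + 1 / \<beta> * ((z - w (Suc (s j))) \<bullet>
          (T *v ((1 / \<tau> (Suc (s j))) *\<^sub>R (w (Suc (s j)) - w (s j)))))))
        \<longlonglongrightarrow> fr z + (ys \<bullet> (B *v (z - ws)) + 1 / \<beta> * ((z - ws) \<bullet> (T *v 0)))"
        by (intro tendsto_intros tendsto_matrix_vector_mult w1_lim y1_lim prox_w)
      show "f (w (Suc (s j))) \<le> ereal (fr z + (y (Suc (s j)) \<bullet> (B *v (z - w (Suc (s j))))
          + 1 / \<beta> * ((z - w (Suc (s j))) \<bullet>
            (T *v ((1 / \<tau> (Suc (s j))) *\<^sub>R (w (Suc (s j)) - w (s j)))))))" for j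
        using w_ineq_real[OF True, of "s j"]
        by (subst pcc_ereal[OF f w_dom]) (simp add: matrix_vector_mult_scaleR)
    qed
    moreover obtain c where "f z = ereal c"
      using pcc_ereal[OF f True] by blast
    ultimately show ?thesis
      by simp
  qed (simp add: edom_def)
  moreover have "res xs ws = 0"
  proof -
    have "(\<lambda>j. res (x (Suc (s j))) (w (Suc (s j)))) \<longlonglongrightarrow> res xs ws"
      unfolding residual_def by (intro tendsto_intros tendsto_matrix_vector_mult x_lim w1_lim)
    \<comment> \<open>The dual update expresses the residual by the vanishing differences of
      multipliers.\<close>
    moreover have "res (x (Suc n)) (w (Suc n))
        = (1 / \<beta>) *\<^sub>R ((1 / \<tau> (Suc n)) *\<^sub>R (y (Suc n) - y n))" for n
      using \<beta> \<tau>_pos[of "Suc n"] by (simp add: y_Suc \<sigma>_Suc)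
    moreover have "(\<lambda>j. (1 / \<beta>) *\<^sub>R ((1 / \<tau> (Suc (s j))) *\<^sub>R (y (Suc (s j)) - y (s j)))) \<longlonglongrightarrow> (1 / \<beta>) *\<^sub>R 0"
      by (intro tendsto_intros tendsto_divide_stepsize_0 lims(2))
    ultimately show ?thesis
      by (simp add: LIMSEQ_unique)
  qed
  ultimately show ?thesis
    by (rule saddle_pointI)
qed

section \<open>Boundedness and convergence of the whole sequence\<close>

lemma energy_bounds:
  shows "(norm (u (n + 2) - xb))\<^sup>2 \<le> (\<psi> - 1) / (\<psi> * lambda_min S) * energy xb wb v n"
    and "(norm (w n - wb))\<^sup>2 \<le> \<beta> / lambda_min T * energy xb wb v n"
    and "(norm (y n - v))\<^sup>2 \<le> \<beta> * energy xb wb v n"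
proof -
  have parts: "0 \<le> \<psi> / (\<psi> - 1) * (mnorm S (u (n + 2) - xb))\<^sup>2"
    "0 \<le> 1 / \<beta> * (mnorm T (wb - w n))\<^sup>2" "0 \<le> 1 / \<beta> * (norm (v - y n))\<^sup>2"
    using \<beta> \<psi> by simp_all
  have lam: "0 < lambda_min S" "0 < lambda_min T"
    using S T by (simp_all add: lambda_min_rayleigh(1))
  have "\<psi> / (\<psi> - 1) * (lambda_min S * (norm (u (n + 2) - xb))\<^sup>2)
      \<le> \<psi> / (\<psi> - 1) * (mnorm S (u (n + 2) - xb))\<^sup>2"
    using mnorm_sq_ge[OF S] \<psi> by (intro mult_left_mono) auto
  also have "\<dots> \<le> energy xb wb v n"
    using parts unfolding energy_def by linarith
  finally show "(norm (u (n + 2) - xb))\<^sup>2 \<le> (\<psi> - 1) / (\<psi> * lambda_min S) * energy xb wb v n"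
    using \<psi> lam by (simp add: field_simps)
  have "1 / \<beta> * (lambda_min T * (norm (wb - w n))\<^sup>2) \<le> 1 / \<beta> * (mnorm T (wb - w n))\<^sup>2"
    using mnorm_sq_ge[OF T] \<beta> by (intro mult_left_mono) auto
  also have "\<dots> \<le> energy xb wb v n"
    using parts unfolding energy_def by linarith
  finally show "(norm (w n - wb))\<^sup>2 \<le> \<beta> / lambda_min T * energy xb wb v n"
    using \<beta> lam by (simp add: field_simps norm_minus_commute)
  have "1 / \<beta> * (norm (v - y n))\<^sup>2 \<le> energy xb wb v n"
    using parts unfolding energy_def by linarith
  then show "(norm (y n - v))\<^sup>2 \<le> \<beta> * energy xb wb v n"
    using \<beta> by (simp add: field_simps norm_minus_commute)
qed

lemma iterates_bounded:
  assumes "saddle_point g f A B b xb wb yb"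
  shows "bounded (range (\<lambda>n. (u (n + 2), w n, y n)))"
proof -
  have "Bseq (energy xb wb yb)"
    using energy_convergent[OF assms] by (auto intro: convergent_imp_Bseq convergentI)
  then obtain C where "0 < C" and "\<forall>n. norm (energy xb wb yb n) \<le> C"
    by (rule BseqE)
  then have C: "energy xb wb yb n \<le> C" for n
    by (simp add: abs_le_iff)
  have bdd: "bounded (range z)"
    if c: "0 \<le> c" and z: "\<And>n. (norm (z n - a))\<^sup>2 \<le> c * energy xb wb yb n"
    for z :: "nat \<Rightarrow> 'z::real_normed_vector" and a c
  proof -
    have "norm (z n - a) \<le> sqrt (c * C)" for n
      by (intro real_le_rsqrt order_trans[OF z] mult_left_mono C c)
    then show ?thesis
      by (auto simp: bounded_any_center[of _ a] dist_norm norm_minus_commute)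
  qed
  have lam: "0 < lambda_min S" "0 < lambda_min T"
    using S T by (simp_all add: lambda_min_rayleigh(1))
  have "bounded (range (\<lambda>n. u (n + 2)))"
    by (rule bdd[OF _ energy_bounds(1)]) (use \<psi> lam in auto)
  moreover have "bounded (range w)"
    by (rule bdd[OF _ energy_bounds(2)]) (use \<beta> lam in auto)
  moreover have "bounded (range y)"
    by (rule bdd[OF _ energy_bounds(3)]) (use \<beta> in auto)
  ultimately have "bounded (range (\<lambda>n. u (n + 2)) \<times> range w \<times> range y)"
    by (intro bounded_Times)
  then show ?thesis
    by (rule bounded_subset) auto
qed

theorem converges_to_saddle_point:
  assumes saddle: "saddle_point g f A B b xb wb yb"
  shows "\<exists>xs ws ys. saddle_point g f A B b xs ws ys \<and>
    (\<lambda>k. (x k, w k, y k)) \<longlonglongrightarrow> (xs, ws, ys)"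
proof -
  obtain p s where s: "strict_mono (s :: nat \<Rightarrow> nat)"
    and p: "((\<lambda>n. (u (n + 2), w n, y n)) \<circ> s) \<longlonglongrightarrow> p"
    using bounded_imp_convergent_subsequence[OF iterates_bounded[OF saddle]] by blast
  obtain xs ws ys where p_eq: "p = (xs, ws, ys)"
    by (cases p) auto
  have us: "(\<lambda>j. u (s j + 2)) \<longlonglongrightarrow> xs" and ws: "(\<lambda>j. w (s j)) \<longlonglongrightarrow> ws"
    and ys: "(\<lambda>j. y (s j)) \<longlonglongrightarrow> ys"
    using tendsto_fst[OF p] tendsto_fst[OF tendsto_snd[OF p]] tendsto_snd[OF tendsto_snd[OF p]]
    by (simp_all add: p_eq o_def)
  have limit_saddle: "saddle_point g f A B b xs ws ys"
    by (rule cluster_point_saddle[OF saddle s us ws ys])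
  let ?E = "energy xs ws ys"
  have "(\<lambda>j. ?E (s j)) \<longlonglongrightarrow> \<psi> / (\<psi> - 1) * ((xs - xs) \<bullet> (S *v (xs - xs)))
      + 1 / \<beta> * ((ws - ws) \<bullet> (T *v (ws - ws))) + 1 / \<beta> * (norm (ys - ys))\<^sup>2"
    unfolding energy_def mnorm_sq[OF S] mnorm_sq[OF T]
    by (intro tendsto_intros tendsto_matrix_vector_mult us ws ys)
  then have "(\<lambda>j. ?E (s j)) \<longlonglongrightarrow> 0"
    by simp
  \<comment> \<open>The cluster point is itself a saddle point, so the energy relative to it
    converges along the whole sequence, and the subsequence identifies the limit as 0.\<close>
  moreover obtain l where l: "?E \<longlonglongrightarrow> l"
    using energy_convergent[OF limit_saddle] by blast
  ultimately have "l = 0"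
    using LIMSEQ_subseq_LIMSEQ[OF l s] by (simp add: o_def LIMSEQ_unique)
  have lim: "z \<longlonglongrightarrow> a" if z: "\<And>n. (norm (z n - a))\<^sup>2 \<le> c * ?E n"
    for z :: "nat \<Rightarrow> 'z::real_normed_vector" and a c
  proof -
    have "(\<lambda>n. (norm (z n - a))\<^sup>2) \<longlonglongrightarrow> 0"
    proof (rule real_tendsto_sandwich)
      show "(\<lambda>n. 0 :: real) \<longlonglongrightarrow> 0"
        by simp
      show "(\<lambda>n. c * ?E n) \<longlonglongrightarrow> 0"
        using tendsto_mult[OF tendsto_const l, of c] \<open>l = 0\<close> by simp
    qed (use z in auto)
    then show ?thesis
      by (simp add: tendsto_norm_zero_iff LIM_zero_iff)
  qed
  have u_lim: "(\<lambda>n. u (n + 2)) \<longlonglongrightarrow> xs"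
    by (rule lim[OF energy_bounds(1)])
  have w_lim: "w \<longlonglongrightarrow> ws"
    by (rule lim[OF energy_bounds(2)])
  have y_lim: "y \<longlonglongrightarrow> ys"
    by (rule lim[OF energy_bounds(3)])
  have "(\<lambda>n. x (Suc n)) \<longlonglongrightarrow> xs"
    using tendsto_add[OF step_limits(3)[OF saddle] u_lim] by simp
  then have "x \<longlonglongrightarrow> xs"
    by (rule LIMSEQ_imp_Suc)
  then have "(\<lambda>k. (x k, w k, y k)) \<longlonglongrightarrow> (xs, ws, ys)"
    by (intro tendsto_Pair w_lim y_lim)
  with limit_saddle show ?thesis
    by blast
qed

text \<open>A rearrangement of \<open>one_step\<close>. It starts at \<open>Suc K\<close> because
  the estimate for iteration \<open>k\<close> comes from step \<open>k - 1\<close>.\<close>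

theorem estimate_index_exists:
  assumes saddle: "saddle_point g f A B b xb wb yb"
  shows "\<exists>K. estimate_index g f A B b S T \<beta> \<psi> \<rho> u x w y \<tau> xb wb K"
proof -
  note sp = saddle_point_imp[OF g f saddle]
  obtain K where K: "\<And>n. K \<le> n \<Longrightarrow> regular_step n"
    using regular_from by blast
  have "ereal (2 * \<tau> k) * (Lagr g f A B b (x k) (w k) v - opt_val g f A B b) \<le>
        ereal (\<psi> / (\<psi> - 1) * ((mnorm S (u (k + 1) - xb))\<^sup>2 - (mnorm S (u (k + 2) - xb))\<^sup>2)
          + 1 / \<beta> * ((mnorm T (wb - w (k - 1)))\<^sup>2 - (mnorm T (wb - w k))\<^sup>2)
          + 1 / \<beta> * ((norm (v - y (k - 1)))\<^sup>2 - (norm (v - y k))\<^sup>2)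
          - 1 / \<beta> * (mnorm T (w k - w (k - 1)))\<^sup>2
          - 1 / \<beta> * (1 - \<rho> / 2) * (norm (y k - y (k - 1)))\<^sup>2
          - \<psi> * \<tau> k / \<tau> (k - 1) * (mnorm S (x k - u (k + 1)))\<^sup>2)" (is "?lhs \<le> ereal ?rhs")
    if kK: "Suc K \<le> k" for k v
  proof -
    obtain n where k: "k = Suc n" and n: "K \<le> n"
      using kK by (cases k) auto
    obtain c d where cd: "g (x k) = ereal c" "f (w k) = ereal d"
      unfolding k using pcc_ereal[OF g x_dom[of n]] pcc_ereal[OF f w_dom[of n]] by blast
    have "2 * \<tau> k * gap xb wb v k \<le> energy xb wb v n - energy xb wb v (Suc n) - decrement n"
      unfolding k by (rule one_step[OF sp(1-3) K[OF n]])
    also have "\<dots> = ?rhs"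
      by (simp add: energy_def decrement_def k right_diff_distrib)
    finally have "ereal (2 * \<tau> k * gap xb wb v k) \<le> ereal ?rhs"
      by simp
    moreover have "?lhs = ereal (2 * \<tau> k * gap xb wb v k)"
      by (simp add: Lagr_def Phi_def sp(4) gap_def cd)
    ultimately show ?thesis
      by simp
  qed
  then show ?thesis
    unfolding estimate_index_def by (intro exI[of _ "Suc K"] conjI allI impI) simp_all
qed

section \<open>Ergodic rate\<close>

text \<open>The ergodic means are unweighted, so \<open>one_step\<close> is divided by \<open>2 \<tau> (Suc n)\<close>; since the step
  sizes increase along regular steps, the energies still telescope.\<close>

lemma gap_sum_tail:
  assumes "xb \<in> edom g" "wb \<in> edom f" "res xb wb = 0"
    and reg: "\<And>n. M \<le> n \<Longrightarrow> regular_step n" and "M \<le> N"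
  shows "(\<Sum>n=M..<N. gap xb wb v (Suc n)) + energy xb wb v N / (2 * \<tau> (Suc N))
    \<le> energy xb wb v M / (2 * \<tau> (Suc M))"
  using \<open>M \<le> N\<close>
proof (induction N rule: dec_induct)
  case (step n)
  have "2 * \<tau> (Suc n) * gap xb wb v (Suc n) \<le> energy xb wb v n - energy xb wb v (Suc n)"
    using one_step[OF assms(1-3) reg[OF step.hyps(1)], of v] decrement_nonneg[of n] by simp
  then have "gap xb wb v (Suc n) \<le> (energy xb wb v n - energy xb wb v (Suc n)) / (2 * \<tau> (Suc n))"
    using \<tau>_pos[of "Suc n"] by (simp add: pos_le_divide_eq mult.commute)
  moreover have "energy xb wb v (Suc n) / (2 * \<tau> (Suc (Suc n))) \<le> energy xb wb v (Suc n) / (2 * \<tau> (Suc n))"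
    using reg[of "Suc n"] step.hyps(1) \<tau>_pos[of "Suc n"] \<tau>_pos[of "Suc (Suc n)"]
    by (intro divide_left_mono energy_nonneg) (auto simp: regular_step_def)
  ultimately show ?case
    using step.IH step.hyps(1) by (simp add: diff_divide_distrib)
qed simp

text \<open>The averages may begin before the steps are regular. The finitely many early terms and
  the energy at the start of the tail are bounded uniformly over the ball of radius
  \<open>R\<close>, so \<open>v\<close> may later depend on \<open>N\<close>.\<close>

lemma gap_sum_bounded:
  assumes "xb \<in> edom g" "wb \<in> edom f" "res xb wb = 0"
  shows "\<exists>C M. K \<le> M \<and> (\<forall>N\<ge>M. \<forall>v. norm v \<le> R \<longrightarrow> (\<Sum>k=K..N. gap xb wb v k) \<le> C)"
proof -
  obtain M0 where M0: "\<And>n. M0 \<le> n \<Longrightarrow> regular_step n"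
    using regular_from by blast
  define M where "M = max K M0"
  \<comment> \<open>The sum bounds the terms up to \<open>M\<close> by Cauchy-Schwarz; the fraction
    bounds the energy at \<open>M\<close>, which depends on \<open>v\<close> only through
    \<open>norm (v - y M)\<close>.\<close>
  define C where "C = (\<Sum>k=K..M. \<bar>gap xb wb 0 k\<bar> + R * norm (res (x k) (w k)))
    + (energy xb wb 0 M + 1 / \<beta> * (R + norm (y M))\<^sup>2) / (2 * \<tau> (Suc M))"
  have "(\<Sum>k=K..N. gap xb wb v k) \<le> C" if N: "M \<le> N" and v: "norm v \<le> R" for N v
  proof -
    have "{K..N} = {K..M} \<union> {Suc M..<Suc N}"
      using N by (auto simp: M_def)
    then have "(\<Sum>k=K..N. gap xb wb v k) =
        (\<Sum>k=K..M. gap xb wb v k) + (\<Sum>k=Suc M..<Suc N. gap xb wb v k)"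
      by (simp only:) (rule sum.union_disjoint, auto)
    moreover have "(\<Sum>k=K..M. gap xb wb v k)
        \<le> (\<Sum>k=K..M. \<bar>gap xb wb 0 k\<bar> + R * norm (res (x k) (w k)))"
    proof (rule sum_mono)
      fix k
      have "v \<bullet> res (x k) (w k) \<le> norm v * norm (res (x k) (w k))"
        by (rule norm_cauchy_schwarz)
      also have "\<dots> \<le> R * norm (res (x k) (w k))"
        using v by (simp add: mult_right_mono)
      finally show "gap xb wb v k \<le> \<bar>gap xb wb 0 k\<bar> + R * norm (res (x k) (w k))"
        by (simp add: gap_def)
    qed
    moreover have "(\<Sum>k=Suc M..<Suc N. gap xb wb v k) \<le> energy xb wb v M / (2 * \<tau> (Suc M))"
    proof -
      have "(\<Sum>n=M..<N. gap xb wb v (Suc n)) + energy xb wb v N / (2 * \<tau> (Suc N))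
          \<le> energy xb wb v M / (2 * \<tau> (Suc M))"
        using M0 by (intro gap_sum_tail assms N) (auto simp: M_def)
      moreover have "0 \<le> energy xb wb v N / (2 * \<tau> (Suc N))"
        using energy_nonneg \<tau>_pos[of "Suc N"] by simp
      ultimately show ?thesis
        unfolding sum.shift_bounds_Suc_ivl by linarith
    qed
    moreover have "energy xb wb v M / (2 * \<tau> (Suc M))
        \<le> (energy xb wb 0 M + 1 / \<beta> * (R + norm (y M))\<^sup>2) / (2 * \<tau> (Suc M))"
    proof -
      have "norm (v - y M) \<le> R + norm (y M)"
        using v norm_triangle_ineq4[of v "y M"] by linarith
      then have "1 / \<beta> * (norm (v - y M))\<^sup>2 \<le> 1 / \<beta> * (R + norm (y M))\<^sup>2"
        using \<beta> by (intro mult_left_mono power_mono) auto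
      moreover have "0 \<le> 1 / \<beta> * (norm (0 - y M))\<^sup>2"
        using \<beta> by simp
      ultimately have "energy xb wb v M \<le> energy xb wb 0 M + 1 / \<beta> * (R + norm (y M))\<^sup>2"
        unfolding energy_def by linarith
      then show ?thesis
        using \<tau>_pos[of "Suc M"] by (simp add: divide_right_mono)
    qed
    ultimately show ?thesis
      by (simp add: C_def)
  qed
  moreover have "K \<le> M"
    by (simp add: M_def)
  ultimately show ?thesis
    by blast
qed

text \<open>Jensen's inequality for \<open>g\<close> and \<open>f\<close>, together with affinity of
  the residual. \<open>1 \<le> K\<close> excludes the starting points, which may lie outside the
  domains.\<close>

lemma ergodic_mean_dom:
  assumes "1 \<le> K" "K \<le> N"
  shows "ergodic_mean K x N \<in> edom g" "ergodic_mean K w N \<in> edom f"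
    and "gr (ergodic_mean K x N) + fr (ergodic_mean K w N) +
      v \<bullet> res (ergodic_mean K x N) (ergodic_mean K w N) - (gr xb + fr wb)
      \<le> (\<Sum>k=K..N. gap xb wb v k) / (real N - real K + 1)"
proof -
  have dom: "x k \<in> edom g" "w k \<in> edom f" if k: "k \<in> {K..N}" for k
  proof -
    obtain n where "k = Suc n"
      using k assms(1) by (cases k) auto
    then show "x k \<in> edom g" "w k \<in> edom f"
      using x_dom w_dom by simp_all
  qed
  have le_g: "g (ergodic_mean K x N) \<le> ereal (ergodic_mean K (\<lambda>k. gr (x k)) N)"
    by (rule pcc_ergodic_mean_le[OF g dom(1) assms(2)])
  have le_f: "f (ergodic_mean K w N) \<le> ereal (ergodic_mean K (\<lambda>k. fr (w k)) N)"
    by (rule pcc_ergodic_mean_le[OF f dom(2) assms(2)])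
  show mx: "ergodic_mean K x N \<in> edom g" and mw: "ergodic_mean K w N \<in> edom f"
    using le_g le_f by (auto simp: edom_def intro: le_less_trans)
  define c where "c = real N - real K + 1"
  have c: "0 < c" "real (card {K..N}) = c"
    using assms(2) by (simp_all add: c_def of_nat_diff)
  have "gr (ergodic_mean K x N) \<le> (\<Sum>k=K..N. gr (x k)) / c"
    using le_g by (subst (asm) pcc_ereal[OF g mx]) (simp add: ergodic_mean_def c_def)
  moreover have "fr (ergodic_mean K w N) \<le> (\<Sum>k=K..N. fr (w k)) / c"
    using le_f by (subst (asm) pcc_ereal[OF f mw]) (simp add: ergodic_mean_def c_def)
  moreover have "v \<bullet> res (ergodic_mean K x N) (ergodic_mean K w N)
      = (\<Sum>k=K..N. v \<bullet> res (x k) (w k)) / c"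
    unfolding residual_ergodic_mean[OF assms(2)]
    by (simp add: ergodic_mean_def inner_sum_right c_def)
  moreover have "gr xb + fr wb = (\<Sum>k=K..N. gr xb + fr wb) / c"
    using c unfolding sum_constant by simp
  ultimately show "gr (ergodic_mean K x N) + fr (ergodic_mean K w N) +
      v \<bullet> res (ergodic_mean K x N) (ergodic_mean K w N) - (gr xb + fr wb)
      \<le> (\<Sum>k=K..N. gap xb wb v k) / (real N - real K + 1)"
    unfolding gap_def c_def[symmetric] sum.distrib sum_subtractf
    by (simp add: add_divide_distrib diff_divide_distrib)
qed

theorem ergodic_rate:
  assumes saddle: "saddle_point g f A B b xb wb yb" and K: "1 \<le> K"
  shows "\<forall>N\<ge>K. \<bar>Phi g f (ergodic_mean K x N) (ergodic_mean K w N) - opt_val g f A B b\<bar> \<noteq> \<infinity>"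
    and "(\<lambda>N. real_of_ereal
        \<bar>Phi g f (ergodic_mean K x N) (ergodic_mean K w N) - opt_val g f A B b\<bar>)
      \<in> O(\<lambda>N. 1 / (real N - real K + 1))"
    and "(\<lambda>N. norm (A *v ergodic_mean K x N + B *v ergodic_mean K w N - b))
      \<in> O(\<lambda>N. 1 / (real N - real K + 1))"
proof -
  note sp = saddle_point_imp[OF g f saddle]
  let ?x = "ergodic_mean K x" and ?w = "ergodic_mean K w"
  define R where "R = norm yb + 1"
  define d where "d N = gr (?x N) + fr (?w N) - (gr xb + fr wb)" for N
  have Phi_diff: "Phi g f (?x N) (?w N) - opt_val g f A B b = ereal (d N)" if N: "K \<le> N" for N
  proof -
    obtain c e where "g (?x N) = ereal c" "f (?w N) = ereal e"
      using pcc_ereal[OF g ergodic_mean_dom(1)[OF K N]]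
        pcc_ereal[OF f ergodic_mean_dom(2)[OF K N]] by blast
    then show ?thesis
      by (simp add: Phi_def sp(4) d_def)
  qed
  then show "\<forall>N\<ge>K. \<bar>Phi g f (?x N) (?w N) - opt_val g f A B b\<bar> \<noteq> \<infinity>"
    by simp
  obtain C M where M: "K \<le> M" and
    C: "\<And>N v. M \<le> N \<Longrightarrow> norm v \<le> R \<Longrightarrow> (\<Sum>k=K..N. gap xb wb v k) \<le> C"
    using gap_sum_bounded[OF sp(1-3), of K R] by blast
  have bounds: "norm (res (?x N) (?w N)) \<le> C * (1 / (real N - real K + 1)) \<and>
      \<bar>d N\<bar> \<le> R * C * (1 / (real N - real K + 1))" if N: "M \<le> N" for N
  proof -
    let ?r = "res (?x N) (?w N)"
    \<comment> \<open>Aligned with the residual, so that their inner product is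
      \<open>R * norm ?r\<close>; for a zero residual \<open>sgn\<close> yields 0 and the identity
      persists.\<close>
    define v where "v = R *\<^sub>R sgn ?r"
    have R: "1 \<le> R"
      by (simp add: R_def)
    have KN: "K \<le> N"
      using M N by simp
    have inner_v: "v \<bullet> ?r = R * norm ?r"
      by (cases "?r = 0") (simp_all add: v_def sgn_div_norm power2_norm_eq_inner[symmetric]
          power2_eq_square)
    have "norm v \<le> R"
      using R by (simp add: v_def norm_sgn)
    then have "(\<Sum>k=K..N. gap xb wb v k) / (real N - real K + 1) \<le> C / (real N - real K + 1)"
      using C[OF N] KN by (intro divide_right_mono) auto
    then have up: "d N + R * norm ?r \<le> C / (real N - real K + 1)"
      using ergodic_mean_dom(3)[OF K KN, of v xb wb] by (simp add: inner_v d_def)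
    \<comment> \<open>The saddle inequality limits how far the objective at the means can fall below
      the optimal value.\<close>
    have "0 \<le> d N + yb \<bullet> ?r"
      using sp(5)[OF ergodic_mean_dom(1,2)[OF K KN]] by (simp add: d_def)
    then have low: "0 \<le> d N + norm yb * norm ?r"
      using norm_cauchy_schwarz[of yb ?r] by linarith
    \<comment> \<open>Combining \<open>up\<close> and \<open>low\<close> leaves the factor
      \<open>R - norm yb = 1\<close> in front of the residual norm.\<close>
    have r_le: "norm ?r \<le> C / (real N - real K + 1)"
      using up low by (simp add: R_def algebra_simps)
    then have "norm yb * norm ?r \<le> norm yb * (C / (real N - real K + 1))"
      by (rule mult_left_mono) simp
    moreover have "0 \<le> norm yb * (C / (real N - real K + 1))"
      using order_trans[OF norm_ge_zero r_le] by (intro mult_nonneg_nonneg) auto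
    moreover have "0 \<le> R * norm ?r"
      using R by simp
    moreover have "R * (C / (real N - real K + 1))
        = norm yb * (C / (real N - real K + 1)) + C / (real N - real K + 1)"
      by (simp add: R_def distrib_right add_divide_distrib)
    ultimately have "\<bar>d N\<bar> \<le> R * (C / (real N - real K + 1))"
      using up low r_le order_trans[OF norm_ge_zero r_le] by linarith
    with r_le show ?thesis
      by simp
  qed
  show "(\<lambda>N. real_of_ereal \<bar>Phi g f (?x N) (?w N) - opt_val g f A B b\<bar>)
      \<in> O(\<lambda>N. 1 / (real N - real K + 1))"
  proof (rule bigoI)
    show "\<forall>\<^sub>F N in sequentially. norm (real_of_ereal \<bar>Phi g f (?x N) (?w N) - opt_val g f A B b\<bar>)
        \<le> R * C * norm (1 / (real N - real K + 1))"
      using eventually_ge_at_top[of M]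
      by eventually_elim (use bounds Phi_diff M in auto)
  qed
  show "(\<lambda>N. norm (A *v ?x N + B *v ?w N - b)) \<in> O(\<lambda>N. 1 / (real N - real K + 1))"
  proof (rule bigoI)
    show "\<forall>\<^sub>F N in sequentially. norm (norm (A *v ?x N + B *v ?w N - b))
        \<le> C * norm (1 / (real N - real K + 1))"
      using eventually_ge_at_top[of M]
      by eventually_elim (use bounds M in \<open>auto simp: residual_def\<close>)
  qed
qed

end

theorem theorem5p1:
  fixes g :: "real^'q \<Rightarrow> ereal" and f :: "real^'p \<Rightarrow> ereal"
    and A :: "real^'q^'m" and B :: "real^'p^'m" and b :: "real^'m"
    and S :: "real^'q^'q" and T :: "real^'p^'p"
    and \<beta> \<psi> \<rho> r1 r :: real and \<xi> :: "nat \<Rightarrow> real"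
    and u x :: "nat \<Rightarrow> real^'q" and w :: "nat \<Rightarrow> real^'p" and y :: "nat \<Rightarrow> real^'m"
    and \<tau> \<sigma> :: "nat \<Rightarrow> real"
    and xb :: "real^'q" and wb :: "real^'p" and yb :: "real^'m"
  assumes "proper_closed_convex g" and "proper_closed_convex f"
    and "standing_assumption g f A B b"
    and "saddle_point g f A B b xb wb yb"
    and "algorithm g f A B b S T \<beta> \<psi> \<rho> r1 r \<xi> u x w y \<tau> \<sigma>"
  shows "(\<exists>xs ws ys. saddle_point g f A B b xs ws ys \<and>
            (\<lambda>k. (x k, w k, y k)) \<longlonglongrightarrow> (xs, ws, ys)) \<and>
         (\<exists>K. estimate_index g f A B b S T \<beta> \<psi> \<rho> u x w y \<tau> xb wb K) \<and>
         (\<forall>K. estimate_index g f A B b S T \<beta> \<psi> \<rho> u x w y \<tau> xb wb K \<longrightarrow>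
            (\<forall>N\<ge>K. \<bar>Phi g f (ergodic_mean K x N) (ergodic_mean K w N) - opt_val g f A B b\<bar> \<noteq> \<infinity>) \<and>
            (\<lambda>N. real_of_ereal
                \<bar>Phi g f (ergodic_mean K x N) (ergodic_mean K w N) - opt_val g f A B b\<bar>)
              \<in> O(\<lambda>N. 1 / (real N - real K + 1)) \<and>
            (\<lambda>N. norm (A *v ergodic_mean K x N + B *v ergodic_mean K w N - b))
              \<in> O(\<lambda>N. 1 / (real N - real K + 1)))"
proof -
  interpret adaptive_golden_admm g f A B b S T \<beta> \<psi> \<rho> r1 r \<xi> u x w y \<tau> \<sigma>
    by unfold_locales (rule assms)+
  have "1 \<le> K" if "estimate_index g f A B b S T \<beta> \<psi> \<rho> u x w y \<tau> xb wb K" for K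
    using that by (simp add: estimate_index_def)
  then show ?thesis
    by (intro conjI impI ergodic_rate[OF assms(4)] converges_to_saddle_point[OF assms(4)]
        estimate_index_exists[OF assms(4)] allI)
qed

end
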